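(* Suppose $\boldsymbol\xi\sim P$ satisfies density-level regular variation with limiting tail measure $\nu^\star$. Suppose $\{\boldsymbol\xi_u\}_{u>0}\in\mathcal T(P)$, and let $(L_1,\dots,L_K)\in\mathcal H_1$ be regular. Then for every nonempty $\mathcal J\subseteq[K]$ under consideration (i.e. $\mathcal J\in\mathfrak J$), $$\mathsf{Law}\big(u^{-1}\boldsymbol\xi_u\,\big|\,\boldsymbol\xi_u\in\mathcal S(u;\mathcal J)\big)\Rightarrow\frac{\nu^\star\big(\,\cdot\,\cap\mathcal S^\star(\mathcal J)\big)}{\nu^\star\big(\mathcal S^\star(\mathcal J)\big)}\qquad\text{as }u\to\infty,$$ where $\Rightarrow$ denotes convergence in distribution (weak convergence).
   Context: Setting. $\|\cdot\|$ is the Euclidean norm on $\mathbb R^d$; $\mathcal E\subset\mathbb R^d$ is a closed cone; $\Theta_{\mathcal E}=\{\boldsymbol z\in\mathcal E:\|\boldsymbol z\|=1\}$; $B_r=\{\boldsymbol z:\|\boldsymbol z\|\le r\}$; $d\boldsymbol\phi$ is surface measure on $\Theta_{\mathcal E}$, so $d\boldsymbol z=r^{d-1}\,dr\,d\boldsymbol\phi$ for $\boldsymbol z=r\boldsymbol\phi$. $\boldsymbol\xi\sim P$ is a random vector with density $f_{\boldsymbol\xi}$ supported on $\mathcal E$. $[K]=\{1,\dots,K\}$. Density-level regular variation: $f_{\boldsymbol\xi}$ is continuous on $B_{r_0}^c\cap\mathcal E$ for some $r_0>0$, and there are $s>0$ and $\varphi^\star:\mathcal E\setminus\{\boldsymbol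 0\}\to(0,\infty)$ with $t^{s+d}f_{\boldsymbol\xi}(t\boldsymbol z)\to\varphi^\star(\boldsymbol z)$ as $t\to\infty$, uniformly over compact subsets of $\mathcal E\setminus\{\boldsymbol 0\}$. $\boldsymbol M_0$-convergence: $\boldsymbol M_0$ is the class of nonnegative Borel measures on $\mathcal E\setminus\{\boldsymbol0\}$ that are finite on $\{\|\boldsymbol z\|>r\}$ for every $r>0$. $\mu_n\to\mu$ in $\boldsymbol M_0$ if $\mu_n(B)\to\mu(B)$ for every Borel $B$ with $\mu(\partial B)=0$ and $\boldsymbol0\notin\operatorname{cl}(B)$ (and similarly for a continuous parameter $u\to\infty$). Limiting tail measure: $\nu^\star$ is the measure on $\mathcal E\setminus\{\boldsymbol0\}$ given in polar coordinates by $d\nu^\star(r,\boldsymbol\phi)=r^{-(s+1)}\varphi^\star(\boldsymbol\phi)\,dr\,d\boldsymbol\phi$; it is the $\boldsymbol M_0$-limit of $t^s\mathbb P(t^{-1}\boldsymbol\xi\in\cdot)$. Tail preservation: a family of $\mathcal E$-valued random vectors $\{\boldsymbol\xi_u\}_{u>0}$ is tail preserving for $\boldsymbol\xi$, written $\{\boldsymbol\xi_u\}\in\mathcal T(P)$, if $u^s\mathbb P(u^{-1}\boldsymbol\xi_u\in\cdot)\to\nu^\star$ in $\boldsymbol M_0$ as $u\to\infty$. Loss systems: measurable functions $L_1,\dots,L_K:\mathcal E\to\mathbb R$ form an asymptotically homogeneous multi-loss system, written $(L_1,\dots,L_K)\in\mathcal H_1$, if for each $j$ there is $L_j^\star:\mathcal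 E\to\mathbb R$ with $\{L_j^\star>0\}\ne\varnothing$ and $t^{-1}L_j(t\boldsymbol z_t)\to L_j^\star(\boldsymbol z)$ whenever $t\to\infty$ and $\boldsymbol z_t\to\boldsymbol z$ in $\mathcal E$. For nonempty $\mathcal J\subseteq[K]$ and $u>0$, $\mathcal S(u;\mathcal J)=\{\boldsymbol z\in\mathcal E:L_j(\boldsymbol z)\ge u\ \forall j\in\mathcal J\}$ and $\mathcal S^\star(\mathcal J)=\{\boldsymbol z\in\mathcal E:L_j^\star(\boldsymbol z)\ge1\ \forall j\in\mathcal J\}$. Let $\mathfrak J$ denote the collection of nonempty subsets of $[K]$ under consideration; the system is regular if $\mathcal S^\star(\mathcal J)$ has nonzero Lebesgue measure for every $\mathcal J\in\mathfrak J$. *)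

theory Defs
  imports "HOL-Probability.Probability"
begin

section \<open>Polar coordinates and the limiting tail measure\<close>

text \<open>
  Surface measure on the unit sphere: a Borel set \<open>A\<close> of directions receives \<open>d\<close> times the Lebesgue
  measure of the sector \<open>{r \<phi> | 0 < r \<le> 1, \<phi> \<in> A}\<close>. This is the normalisation for which
  \<open>dz = r^(d-1) dr d\<phi>\<close>.
\<close>

definition sphere_measure :: "'a::euclidean_space measure" where
  "sphere_measure =
     scale_measure (ennreal (real DIM('a)))
       (distr (restrict_space lborel (cball 0 1 - {0}))
              (restrict_space borel (sphere 0 1)) (\<lambda>z. z /\<^sub>R norm z))"

definition unit_directions :: "'a::euclidean_space set \<Rightarrow> 'a set" where
  "unit_directions E = {z \<in> E. norm z = 1}"

definition tail_measure ::
    "'a::euclidean_space set \<Rightarrow> real \<Rightarrow> ('a \<Rightarrow> real) \<Rightarrow> 'a measure" where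
  "tail_measure E s \<phi>s =
     distr (density (restrict_space lborel {0<..} \<Otimes>\<^sub>M restrict_space sphere_measure (unit_directions E))
                    (\<lambda>(r, \<phi>). ennreal (r powr (- (s + 1)) * \<phi>s \<phi>)))
           (restrict_space borel (E - {0})) (\<lambda>(r, \<phi>). r *\<^sub>R \<phi>)"

definition density_regular_variation ::
    "'a::euclidean_space set \<Rightarrow> ('a \<Rightarrow> real) \<Rightarrow> real \<Rightarrow> ('a \<Rightarrow> real) \<Rightarrow> bool" where
  "density_regular_variation E f s \<phi>s \<longleftrightarrow>
     (\<exists>r0>0. continuous_on (E - cball 0 r0) f) \<and>
     0 < s \<and> (\<forall>z\<in>E - {0}. 0 < \<phi>s z) \<and>
     (\<forall>C. compact C \<and> C \<subseteq> E - {0} \<longrightarrow>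
        uniform_limit C (\<lambda>t z. t powr (s + real DIM('a)) * f (t *\<^sub>R z)) \<phi>s at_top)"


section \<open>Convergence away from the origin and tail preservation\<close>

definition M0 :: "'a::euclidean_space set \<Rightarrow> 'a measure set" where
  "M0 E = {\<mu>. sets \<mu> = sets (restrict_space borel (E - {0})) \<and>
              (\<forall>r>0. emeasure \<mu> {z \<in> E - {0}. r < norm z} < \<infinity>)}"

text \<open>
  The boundary of \<open>B\<close> is taken relative to \<open>E - {0}\<close>, the space on which the measures live; the
  boundary of \<open>E\<close> in the ambient space may carry mass and must not enter.
\<close>

definition M0_tendsto ::
    "'a::euclidean_space set \<Rightarrow> (real \<Rightarrow> 'a measure) \<Rightarrow> 'a measure \<Rightarrow> real filter \<Rightarrow> bool" where
  "M0_tendsto E \<mu> \<nu> F \<longleftrightarrow>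
     (\<forall>\<^sub>F u in F. \<mu> u \<in> M0 E) \<and> \<nu> \<in> M0 E \<and>
     (\<forall>B. B \<in> sets borel \<and> B \<subseteq> E - {0} \<and> 0 \<notin> closure B \<and>
          emeasure \<nu> (top_of_set (E - {0}) frontier_of B) = 0 \<longrightarrow>
          ((\<lambda>u. emeasure (\<mu> u) B) \<longlongrightarrow> emeasure \<nu> B) F)"

definition tail_preserving ::
    "'w measure \<Rightarrow> 'a::euclidean_space set \<Rightarrow> real \<Rightarrow> 'a measure \<Rightarrow> (real \<Rightarrow> 'w \<Rightarrow> 'a) \<Rightarrow> bool" where
  "tail_preserving M E s \<nu> X \<longleftrightarrow>
     (\<forall>u>0. X u \<in> borel_measurable M \<and> (\<forall>\<omega>\<in>space M. X u \<omega> \<in> E)) \<and>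
     M0_tendsto E
       (\<lambda>u. scale_measure (ennreal (u powr s))
              (restrict_space (distr M borel (\<lambda>\<omega>. X u \<omega> /\<^sub>R u)) (E - {0})))
       \<nu> at_top"


section \<open>Loss systems\<close>

definition asymptotically_homogeneous ::
    "'a::euclidean_space set \<Rightarrow> nat \<Rightarrow> (nat \<Rightarrow> 'a \<Rightarrow> real) \<Rightarrow> (nat \<Rightarrow> 'a \<Rightarrow> real) \<Rightarrow> bool" where
  "asymptotically_homogeneous E K L Ls \<longleftrightarrow>
     (\<forall>j\<in>{1..K}.
        L j \<in> borel_measurable (restrict_space borel E) \<and>
        (\<exists>z\<in>E. 0 < Ls j z) \<and>
        (\<forall>\<zeta> z. (\<forall>t. \<zeta> t \<in> E) \<and> z \<in> E \<and> (\<zeta> \<longlongrightarrow> z) at_top \<longrightarrow>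
           ((\<lambda>t. inverse t * L j (t *\<^sub>R \<zeta> t)) \<longlongrightarrow> Ls j z) at_top))"

definition joint_exceedance ::
    "'a set \<Rightarrow> (nat \<Rightarrow> 'a \<Rightarrow> real) \<Rightarrow> real \<Rightarrow> nat set \<Rightarrow> 'a set" where
  "joint_exceedance E L u J = {z \<in> E. \<forall>j\<in>J. u \<le> L j z}"

definition regular_system ::
    "'a::euclidean_space set \<Rightarrow> (nat \<Rightarrow> 'a \<Rightarrow> real) \<Rightarrow> nat set set \<Rightarrow> bool" where
  "regular_system E Ls \<J> \<longleftrightarrow>
     (\<forall>J\<in>\<J>. emeasure lebesgue (joint_exceedance E Ls 1 J) \<noteq> 0)"


section \<open>Conditional laws and weak convergence\<close>

definition conditional_law ::
    "'w measure \<Rightarrow> ('w \<Rightarrow> 'a::euclidean_space) \<Rightarrow> 'w set \<Rightarrow> 'a measure" where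
  "conditional_law M X A = distr (uniform_measure M A) borel X"

text \<open>
  The probability requirements make precise that conditional laws are only meant where the
  conditioning event has positive probability: \<^const>\<open>uniform_measure\<close> on a null event is the zero measure.
\<close>

definition weakly_converges ::
    "(real \<Rightarrow> 'a::euclidean_space measure) \<Rightarrow> 'a measure \<Rightarrow> real filter \<Rightarrow> bool" where
  "weakly_converges \<mu> \<nu> F \<longleftrightarrow>
     (\<forall>\<^sub>F u in F. sets (\<mu> u) = sets borel \<and> prob_space (\<mu> u)) \<and>
     sets \<nu> = sets borel \<and> prob_space \<nu> \<and>
     (\<forall>g::'a \<Rightarrow> real. continuous_on UNIV g \<and> bounded (range g) \<longrightarrow>
        ((\<lambda>u. \<integral>z. g z \<partial>\<mu> u) \<longlongrightarrow> (\<integral>z. g z \<partial>\<nu>)) F)"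

end

theory Submission imports Defs begin

text \<open>
  Write \<open>p\<^sub>u B = u\<^sup>s P(\<xi>\<^sub>u / u \<in> B)\<close>, so that the conditional law is the quotient
  \<open>p\<^sub>u (S\<^sub>u \<inter> B) / p\<^sub>u S\<^sub>u\<close> with \<open>S\<^sub>u = {z \<in> E. \<forall>j\<in>J. L\<^sub>j (u z) \<ge> u}\<close>. The limit losses are continuous
  and homogeneous of degree one, and \<open>L\<^sub>j (u z) / u\<close> converges to them uniformly on compact sets.
  Hence the symmetric difference of \<open>S\<^sub>u\<close> and the limit set \<open>S\<close> eventually lies in
  \<open>W n = {z. |z| \<ge> n + 1 \<or> (\<exists>j\<in>J. |Ls\<^sub>j z - 1| \<le> 1 / (n + 2))}\<close>. By homogeneity every ray meets a nonzero
  level set of \<open>Ls\<^sub>j\<close> or of the norm at most once, so these level sets are null for \<open>\<nu>\<close>; therefore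
  \<open>W n\<close> is a continuity set, its \<open>\<nu>\<close>-measure tends to 0, and \<open>p\<^sub>u (S\<^sub>u \<inter> B)\<close> has the same limit as
  \<open>p\<^sub>u (S \<inter> B)\<close>. It is enough to take \<open>B = {g \<le> t}\<close> with \<open>g\<close> bounded and continuous and \<open>{g = t}\<close>
  null: pushing the laws forward along \<open>g\<close> reduces weak convergence to that of distribution
  functions on the real line.
\<close>

section \<open>Null sets of the tail measure\<close>

lemma closed_superlevel:
  fixes h :: "'j \<Rightarrow> 'a::topological_space \<Rightarrow> 'b::linorder_topology"
  assumes "closed E" and cont: "\<And>j. j \<in> J \<Longrightarrow> continuous_on E (h j)"
  shows "closed {z \<in> E. \<forall>j\<in>J. a \<le> h j z}"
proof -
  have "closed (E \<inter> (\<Inter>j\<in>J. E \<inter> h j -` {a..}))"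
    using \<open>closed E\<close> cont by (intro closed_Int closed_INT ballI continuous_closed_preimage) auto
  also have "E \<inter> (\<Inter>j\<in>J. E \<inter> h j -` {a..}) = {z \<in> E. \<forall>j\<in>J. a \<le> h j z}" by auto
  finally show ?thesis .
qed

section \<open>Surface measure on the unit sphere and its null sets\<close>

lemma measurable_sphere_projection:
  "(\<lambda>z::'a::euclidean_space. z /\<^sub>R norm z)
     \<in> restrict_space lborel (cball 0 1 - {0}) \<rightarrow>\<^sub>M restrict_space borel (sphere 0 1)"
proof (rule measurable_restrict_space2)
  show "(\<lambda>z::'a. z /\<^sub>R norm z) \<in> restrict_space lborel (cball 0 1 - {0}) \<rightarrow>\<^sub>M borel"
    by (intro measurable_restrict_space1) (simp add: borel_measurable_scaleR)
qed (auto simp: space_restrict_space)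

lemma sets_sphere_measure [measurable_cong]:
  "sets (sphere_measure :: 'a::euclidean_space measure) = sets (restrict_space borel (sphere 0 1))"
  by (simp add: sphere_measure_def)

lemma space_sphere_measure:
  "space (sphere_measure :: 'a::euclidean_space measure) = sphere 0 1"
  by (simp add: sphere_measure_def space_scale_measure space_restrict_space)

text \<open>The mass is controlled by the dimension times the volume of the unit ball. Finiteness
  makes the polar product sigma-finite, so that Fubini applies to it.\<close>

lemma finite_sphere_measure: "finite_measure (sphere_measure :: 'a::euclidean_space measure)"
proof
  have "emeasure (distr (restrict_space lborel (cball 0 1 - {0}))
          (restrict_space borel (sphere 0 1)) (\<lambda>z::'a. z /\<^sub>R norm z)) (sphere 0 1)
      \<le> emeasure (restrict_space lborel (cball 0 1 - {0::'a})) (cball 0 1 - {0})"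
    by (subst emeasure_distr[OF measurable_sphere_projection])
       (auto simp: sets_restrict_space_iff space_restrict_space intro!: emeasure_mono)
  also have "\<dots> \<le> emeasure lborel (cball (0::'a) 1)"
    by (simp add: emeasure_restrict_space emeasure_mono)
  also have "\<dots> < \<infinity>" by (rule emeasure_lborel_cball_finite)
  finally show "emeasure (sphere_measure :: 'a measure) (space sphere_measure) \<noteq> \<infinity>"
    by (simp add: space_sphere_measure) (simp add: sphere_measure_def ennreal_mult_eq_top_iff)
qed

text \<open>Surface measure is a positive multiple of the image of Lebesgue measure on the punctured
  unit ball under radial projection. A positive factor keeps the null sets, so a property of almost
  all directions can be tested on almost all points of the ball.\<close>

lemma AE_sphere_measure_iff:
  fixes P :: "'a::euclidean_space \<Rightarrow> bool"
  assumes P: "{\<phi> \<in> sphere 0 1. P \<phi>} \<in> sets borel"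
  shows "(AE \<phi> in sphere_measure. P \<phi>) \<longleftrightarrow>
         (AE z in lborel. z \<in> cball 0 1 - {0} \<longrightarrow> P (z /\<^sub>R norm z))"
proof -
  have "(AE \<phi> in sphere_measure. P \<phi>) \<longleftrightarrow> (AE \<phi> in distr (restrict_space lborel (cball 0 1 - {0}))
              (restrict_space borel (sphere 0 1)) (\<lambda>z::'a. z /\<^sub>R norm z). P \<phi>)"
    by (simp add: eventually_ae_filter null_sets_def sphere_measure_def space_scale_measure)
  also have "\<dots> \<longleftrightarrow> (AE z in restrict_space lborel (cball 0 1 - {0}). P (z /\<^sub>R norm z))"
    using P by (intro AE_distr_iff measurable_sphere_projection)
       (auto simp: space_restrict_space sets_restrict_space_iff)
  also have "\<dots> \<longleftrightarrow> (AE z in lborel. z \<in> cball 0 1 - {0} \<longrightarrow> P (z /\<^sub>R norm z))"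
    by (intro AE_restrict_space_iff) auto
  finally show ?thesis .
qed

lemma sets_tail_measure:
  "sets (tail_measure E s \<phi>s) = sets (restrict_space borel (E - {0}))"
  by (simp add: tail_measure_def)

text \<open>The polar density is strictly positive, so only the set of pairs
  \<open>(r, \<phi>)\<close> landing in \<open>B\<close> matters. By Fubini it is null iff almost
  every ray meets \<open>B\<close> in a null set of radii; directions are then replaced by points of
  the unit ball. The values of \<open>\<phi>s\<close> thus drop out, leaving a statement about rays
  and Lebesgue measure.\<close>

lemma emeasure_tail_measure_eq_0_iff:
  fixes E :: "'a::euclidean_space set"
  assumes E: "closed E" "cone E"
    and cont: "continuous_on (unit_directions E) \<phi>s"
    and pos: "\<And>z. z \<in> unit_directions E \<Longrightarrow> 0 < \<phi>s z"
    and B: "B \<in> sets borel" "B \<subseteq> E - {0}"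
  shows "emeasure (tail_measure E s \<phi>s) B = 0 \<longleftrightarrow>
    (AE z in lborel. z \<in> E \<inter> cball 0 1 - {0} \<longrightarrow>
       (AE r in lborel. 0 < r \<longrightarrow> (r / norm z) *\<^sub>R z \<notin> B))"
proof -
  define U where "U = unit_directions E"
  define R where "R = restrict_space lborel {0::real<..}"
  define S where "S = restrict_space sphere_measure U"
  define N where "N = R \<Otimes>\<^sub>M S"
  define h where "h = (\<lambda>(r, \<phi>). ennreal (r powr (- (s + 1)) * \<phi>s \<phi>))"
  have Ueq: "U = E \<inter> sphere 0 1" by (auto simp: U_def unit_directions_def)
  have Uclosed: "closed U" unfolding Ueq using E by auto
  have Usets: "U \<in> sets (sphere_measure :: 'a measure)"
    using Uclosed by (auto simp: sets_sphere_measure sets_restrict_space_iff Ueq)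
  have setsS: "sets S = sets (restrict_space borel U)"
    unfolding S_def by (auto simp: sets_restrict_space sets_sphere_measure Ueq)
  have spS: "space S = U" using setsS by (simp add: sets_eq_imp_space_eq space_restrict_space)
  have spR: "space R = {0<..}" by (simp add: R_def space_restrict_space)
  interpret R: sigma_finite_measure R
    unfolding R_def by (intro sigma_finite_measure_restrict_space sigma_finite_lborel) auto
  interpret S: finite_measure S
    unfolding S_def by (intro finite_measure_restrict_space finite_sphere_measure Usets)
  interpret P: pair_sigma_finite R S ..
  have id_S: "(\<lambda>x. x) \<in> S \<rightarrow>\<^sub>M borel"
    by (simp add: measurable_cong_sets[OF setsS refl] measurable_restrict_space1)
  have id_R: "(\<lambda>x. x) \<in> R \<rightarrow>\<^sub>M borel"
    unfolding R_def by (intro measurable_restrict_space1) simp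
  have phi: "\<phi>s \<in> borel_measurable S"
    unfolding measurable_cong_sets[OF setsS refl]
    using cont U_def by (intro borel_measurable_continuous_on_restrict) simp
  have mfst: "fst \<in> borel_measurable N" unfolding N_def
    by (rule measurable_compose[OF measurable_fst id_R])
  have msnd: "snd \<in> borel_measurable N" unfolding N_def
    by (rule measurable_compose[OF measurable_snd id_S])
  have mphi: "(\<lambda>x. \<phi>s (snd x)) \<in> borel_measurable N" unfolding N_def
    by (intro measurable_compose[OF measurable_snd phi])
  have h: "h \<in> borel_measurable N"
    unfolding h_def split_beta using mfst mphi by measurable
  have T0: "(\<lambda>x. fst x *\<^sub>R snd x) \<in> N \<rightarrow>\<^sub>M borel" using mfst msnd by measurable
  have spN: "space N = {0<..} \<times> U" by (simp add: N_def space_pair_measure spR spS)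
  have T: "(\<lambda>(r, \<phi>). r *\<^sub>R \<phi>) \<in> N \<rightarrow>\<^sub>M restrict_space borel (E - {0})"
    using T0 E(2) by (intro measurable_restrict_space2)
      (auto simp: split_beta spN Ueq cone_def)
  have Bs: "B \<in> sets (restrict_space borel (E - {0}))"
    using B E by (auto simp: sets_restrict_space_iff)
  have BN: "{x \<in> space N. fst x *\<^sub>R snd x \<in> B} \<in> sets N"
    using measurable_sets[OF T0 B(1)] by (simp add: vimage_def Int_def conj_commute)
  have BN': "{x \<in> space N. fst x *\<^sub>R snd x \<notin> B} \<in> sets N"
    using BN by (rule sets.sets_Collect_neg)
  have "emeasure (tail_measure E s \<phi>s) B = 0 \<longleftrightarrow>
      B \<in> null_sets (distr (density N h) (restrict_space borel (E - {0})) (\<lambda>(r, \<phi>). r *\<^sub>R \<phi>))"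
    using Bs by (auto simp: null_sets_def tail_measure_def N_def R_def S_def h_def U_def)
  also have "\<dots> \<longleftrightarrow> {x \<in> space N. fst x *\<^sub>R snd x \<in> B} \<in> null_sets (density N h)"
    using T Bs by (subst null_sets_distr_iff) (auto simp: vimage_def Int_def split_beta conj_commute)
  also have "\<dots> \<longleftrightarrow> (AE x in N. fst x *\<^sub>R snd x \<in> B \<longrightarrow> h x = 0)"
    using BN by (subst null_sets_density_iff[OF h]) (auto intro: AE_cong)
  also have "\<dots> \<longleftrightarrow> (AE x in N. fst x *\<^sub>R snd x \<notin> B)"
    using pos by (intro AE_cong)
      (force simp: h_def spN split_beta U_def ennreal_eq_0_iff mult_le_0_iff not_le)
  also have "\<dots> \<longleftrightarrow> (AE r in R. AE \<phi> in S. r *\<^sub>R \<phi> \<notin> B)"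
    unfolding N_def by (rule P.AE_pair_iff[symmetric]) (use BN' N_def in simp)
  also have "\<dots> \<longleftrightarrow> (AE \<phi> in S. AE r in R. r *\<^sub>R \<phi> \<notin> B)"
    by (rule P.AE_commute) (use BN' N_def in simp)
  also have "\<dots> \<longleftrightarrow> (AE \<phi> in sphere_measure. \<phi> \<in> U \<longrightarrow> (AE r in R. r *\<^sub>R \<phi> \<notin> B))"
    unfolding S_def using Usets by (intro AE_restrict_space_iff) auto
  also have "\<dots> \<longleftrightarrow> (AE z in lborel. z \<in> cball 0 1 - {0} \<longrightarrow> z /\<^sub>R norm z \<in> U \<longrightarrow>
                    (AE r in R. r *\<^sub>R (z /\<^sub>R norm z) \<notin> B))"
  \<comment> \<open>The transfer from sphere to ball needs a measurable set of directions. Avoiding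
    \<open>B\<close> almost everywhere along a ray is rewritten as the vanishing of the length of a
    section, which is measurable in the direction; outside \<open>U\<close> the implication is
    vacuous, so those directions are all adjoined.\<close>
  proof (rule AE_sphere_measure_iff)
    have m: "(\<lambda>\<phi>. emeasure R {r \<in> space R. r *\<^sub>R \<phi> \<in> B}) \<in> borel_measurable S"
      using P.measurable_emeasure_Pair2[OF BN[unfolded N_def]]
      by (rule measurable_cong[THEN iffD1, rotated])
         (auto simp: space_pair_measure intro!: arg_cong[where f="emeasure R"])
    have ae: "(AE r in R. r *\<^sub>R \<phi> \<notin> B) \<longleftrightarrow> emeasure R {r \<in> space R. r *\<^sub>R \<phi> \<in> B} = 0"
      if "\<phi> \<in> U" for \<phi>
    proof (rule AE_iff_measurable)
      have "(\<lambda>r. r *\<^sub>R \<phi>) \<in> R \<rightarrow>\<^sub>M borel" using id_R by measurable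
      from measurable_sets[OF this B(1)]
      show "{r \<in> space R. r *\<^sub>R \<phi> \<in> B} \<in> sets R" by (simp add: vimage_def Int_def conj_commute)
    qed auto
    have "{\<phi> \<in> space S. emeasure R {r \<in> space R. r *\<^sub>R \<phi> \<in> B} = 0} \<in> sets S"
      using m by measurable
    also have "{\<phi> \<in> space S. emeasure R {r \<in> space R. r *\<^sub>R \<phi> \<in> B} = 0}
             = {\<phi> \<in> U. AE r in R. r *\<^sub>R \<phi> \<notin> B}"
      using ae by (auto simp: spS)
    finally have "{\<phi> \<in> U. AE r in R. r *\<^sub>R \<phi> \<notin> B} \<in> sets borel"
      using Uclosed by (simp add: setsS sets_restrict_space_iff)
    then have "(sphere 0 1 - U) \<union> {\<phi> \<in> U. AE r in R. r *\<^sub>R \<phi> \<notin> B} \<in> sets borel"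
      using Uclosed by auto
    also have "(sphere 0 1 - U) \<union> {\<phi> \<in> U. AE r in R. r *\<^sub>R \<phi> \<notin> B} =
       {\<phi> \<in> sphere 0 1. \<phi> \<in> U \<longrightarrow> (AE r in R. r *\<^sub>R \<phi> \<notin> B)}" by (auto simp: Ueq)
    finally show "{\<phi> \<in> sphere 0 1. \<phi> \<in> U \<longrightarrow> (AE r in R. r *\<^sub>R \<phi> \<notin> B)} \<in> sets borel" .
  qed
  also have "\<dots> \<longleftrightarrow> (AE z in lborel. z \<in> E \<inter> cball 0 1 - {0} \<longrightarrow>
       (AE r in lborel. 0 < r \<longrightarrow> (r / norm z) *\<^sub>R z \<notin> B))"
  proof (intro AE_cong)
    fix z :: 'a
    have "(AE r in R. r *\<^sub>R (z /\<^sub>R norm z) \<notin> B) \<longleftrightarrow> (AE r in lborel. 0 < r \<longrightarrow> (r / norm z) *\<^sub>R z \<notin> B)"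
      unfolding R_def by (subst AE_restrict_space_iff) (auto simp: divide_inverse)
    moreover have "z /\<^sub>R norm z \<in> U \<longleftrightarrow> z \<in> E" if "z \<noteq> 0"
    proof
      assume "z /\<^sub>R norm z \<in> U"
      then have "norm z *\<^sub>R (z /\<^sub>R norm z) \<in> E" using E(2) unfolding Ueq by (auto simp: cone_def)
      then show "z \<in> E" using that by simp
    next
      assume "z \<in> E" then show "z /\<^sub>R norm z \<in> U" using E(2) that unfolding Ueq cone_def by auto
    qed
    ultimately show "(z \<in> cball 0 1 - {0} \<longrightarrow> z /\<^sub>R norm z \<in> U \<longrightarrow>
                    (AE r in R. r *\<^sub>R (z /\<^sub>R norm z) \<notin> B)) \<longleftrightarrow>
        (z \<in> E \<inter> cball 0 1 - {0} \<longrightarrow> (AE r in lborel. 0 < r \<longrightarrow> (r / norm z) *\<^sub>R z \<notin> B))"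
      by auto
  qed
  finally show ?thesis .
qed

text \<open>Along the ray through \<open>z\<close> the function \<open>h\<close> is linear in the
  radius, so it takes a nonzero value at most once, and a single radius is Lebesgue null.\<close>

lemma emeasure_tail_measure_level_set:
  fixes E :: "'a::euclidean_space set" and h :: "'a \<Rightarrow> real"
  assumes E: "closed E" "cone E"
    and cont: "continuous_on (unit_directions E) \<phi>s"
    and pos: "\<And>z. z \<in> unit_directions E \<Longrightarrow> 0 < \<phi>s z"
    and hc: "continuous_on E h"
    and hom: "\<And>z c. z \<in> E \<Longrightarrow> 0 < c \<Longrightarrow> h (c *\<^sub>R z) = c * h z"
    and "a \<noteq> 0"
  shows "emeasure (tail_measure E s \<phi>s) {z \<in> E - {0}. h z = a} = 0"
proof (subst emeasure_tail_measure_eq_0_iff[OF E cont pos])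
  have "closed {z \<in> E. h z = a}"
    using continuous_closed_preimage_constant[OF hc E(1)] by simp
  then have "{z \<in> E. h z = a} - {0} \<in> sets borel" by auto
  moreover have "{z \<in> E. h z = a} - {0} = {z \<in> E - {0}. h z = a}" by auto
  ultimately show "{z \<in> E - {0}. h z = a} \<in> sets borel" by simp
  have "AE r in lborel. 0 < r \<longrightarrow> (r / norm z) *\<^sub>R z \<notin> {z \<in> E - {0}. h z = a}"
    if "z \<in> E \<inter> cball 0 1 - {0}" for z
    \<comment> \<open>This is the only radius at which the ray can hit the level. If
      \<open>h z = 0\<close> the quotient is 0 by convention, but then the ray misses the level
      because \<open>a \<noteq> 0\<close>.\<close>
    using AE_lborel_singleton[of "a * norm z / h z"]
  proof (rule AE_mp, intro AE_I2 impI notI)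
    fix r :: real
    assume "r \<noteq> a * norm z / h z" "0 < r" "(r / norm z) *\<^sub>R z \<in> {z \<in> E - {0}. h z = a}"
    with that hom[of z "r / norm z"] have "r / norm z * h z = a" "norm z \<noteq> 0" by auto
    then have "r * h z = a * norm z" by (simp add: field_simps)
    moreover from this have "h z \<noteq> 0" using \<open>a \<noteq> 0\<close> \<open>norm z \<noteq> 0\<close> by auto
    ultimately have "r = a * norm z / h z" by (simp add: eq_divide_eq)
    then show False using \<open>r \<noteq> a * norm z / h z\<close> by contradiction
  qed
  then show "AE z in lborel. z \<in> E \<inter> cball 0 1 - {0} \<longrightarrow>
     (AE r in lborel. 0 < r \<longrightarrow> (r / norm z) *\<^sub>R z \<notin> {z \<in> E - {0}. h z = a})"
    by auto
qed auto

text \<open>If the tail measure vanished, then so would Lebesgue measure on the part of the cone over the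
  superlevel set inside the unit ball, and hence, by scaling, on the whole cone.\<close>

lemma emeasure_tail_measure_superlevel_pos:
  fixes E :: "'a::euclidean_space set" and h :: "'j \<Rightarrow> 'a \<Rightarrow> real"
  assumes E: "closed E" "cone E"
    and cont: "continuous_on (unit_directions E) \<phi>s"
    and pos: "\<And>z. z \<in> unit_directions E \<Longrightarrow> 0 < \<phi>s z"
    and J: "finite J"
    and hc: "\<And>j. j \<in> J \<Longrightarrow> continuous_on E (h j)"
    and hom: "\<And>j z c. j \<in> J \<Longrightarrow> z \<in> E \<Longrightarrow> 0 < c \<Longrightarrow> h j (c *\<^sub>R z) = c * h j z"
    and leb: "emeasure lebesgue {z \<in> E. \<forall>j\<in>J. 1 \<le> h j z} \<noteq> 0"
  shows "emeasure (tail_measure E s \<phi>s) {z \<in> E - {0}. \<forall>j\<in>J. 1 \<le> h j z} \<noteq> 0"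
proof
  define B where "B = {z \<in> E - {0}. \<forall>j\<in>J. 1 \<le> h j z}"
  define C where "C = {z \<in> E - {0}. \<forall>j\<in>J. 0 < h j z}"
  have "closed {z \<in> E. \<forall>j\<in>J. 1 \<le> h j z}" using E(1) hc by (rule closed_superlevel)
  then have "{z \<in> E. \<forall>j\<in>J. 1 \<le> h j z} - {0} \<in> sets borel" by auto
  also have "{z \<in> E. \<forall>j\<in>J. 1 \<le> h j z} - {0} = B" by (auto simp: B_def)
  finally have Bm: "B \<in> sets borel" .
  assume "emeasure (tail_measure E s \<phi>s) {z \<in> E - {0}. \<forall>j\<in>J. 1 \<le> h j z} = 0"
  then have "emeasure (tail_measure E s \<phi>s) B = 0" by (simp add: B_def)
  then have ae: "AE z in lborel. z \<in> E \<inter> cball 0 1 - {0} \<longrightarrow>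
       (AE r in lborel. 0 < r \<longrightarrow> (r / norm z) *\<^sub>R z \<notin> B)"
    by (subst (asm) emeasure_tail_measure_eq_0_iff[OF E cont pos Bm]) (auto simp: B_def)
  \<comment> \<open>Homogeneity moves every point of \<open>C\<close> into \<open>B\<close> once its
    radius is large. Its ray would therefore have a radius interval of length one inside
    \<open>B\<close>, contradicting that almost every radius avoids \<open>B\<close>.\<close>
  have "AE z in lborel. z \<notin> C \<inter> cball 0 1"
    using ae
  proof (rule AE_mp, intro AE_I2 impI notI)
    fix z assume z: "z \<in> C \<inter> cball 0 1"
      and "z \<in> E \<inter> cball 0 1 - {0} \<longrightarrow> (AE r in lborel. 0 < r \<longrightarrow> (r / norm z) *\<^sub>R z \<notin> B)"
    then have ae_r: "AE r in lborel. 0 < r \<longrightarrow> (r / norm z) *\<^sub>R z \<notin> B" by (auto simp: C_def)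
    have z': "z \<in> E" "norm z > 0" using z by (auto simp: C_def)
    have "\<forall>\<^sub>F r in at_top. 1 \<le> r / norm z * h j z" if "j \<in> J" for j
    proof -
      have p: "0 < h j z / norm z" using z z' that by (auto simp: C_def)
      have "\<forall>\<^sub>F r in at_top. norm z / h j z \<le> r" by (rule eventually_ge_at_top)
      then show ?thesis
        by eventually_elim (use p z' in \<open>auto simp: field_simps zero_less_divide_iff\<close>)
    qed
    then have "\<forall>\<^sub>F r in at_top. 0 < r \<and> (\<forall>j\<in>J. 1 \<le> r / norm z * h j z)"
      using J by (auto intro!: eventually_conj eventually_gt_at_top eventually_ball_finite)
    then obtain c where c: "\<And>r. c \<le> r \<Longrightarrow> 0 < r \<and> (\<forall>j\<in>J. 1 \<le> r / norm z * h j z)"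
      by (auto simp: eventually_at_top_linorder)
    have "(r / norm z) *\<^sub>R z \<in> B" if "c \<le> r" for r
      using c[OF that] z' E(2) hom[OF _ z'(1), of _ "r / norm z"] by (auto simp: B_def cone_def)
    then have "AE r in lborel. r \<notin> {c..c + 1}"
      using ae_r c by (auto elim!: eventually_mono)
    then have "emeasure lborel {c..c + 1} = 0"
      by (subst (asm) AE_iff_measurable[of "{c..c + 1}"]) auto
    then show False by simp
  qed
  then obtain Z where "Z \<in> null_sets lborel" "{z \<in> space lborel. \<not> z \<notin> C \<inter> cball 0 1} \<subseteq> Z"
    unfolding eventually_ae_filter by blast
  then have "Z \<in> null_sets lborel" "C \<inter> cball 0 1 \<subseteq> Z" by auto
  then have neg: "negligible (C \<inter> cball 0 1)"
    using negligible_iff_null_sets null_sets_completionI negligible_subset by blast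
  \<comment> \<open>\<open>C\<close> is invariant under positive scaling, so countably many dilates
    of its part in the unit ball cover it, and dilations preserve negligible sets. The factor
    \<open>Suc n\<close> keeps the division legitimate when \<open>n = 0\<close>.\<close>
  have "C \<subseteq> (\<Union>n::nat. (\<lambda>z. real (Suc n) *\<^sub>R z) ` (C \<inter> cball 0 1))"
  proof
    fix z assume z: "z \<in> C"
    obtain n where n: "norm z \<le> real n" using real_arch_simple by blast
    define w where "w = (1 / real (Suc n)) *\<^sub>R z"
    have "w \<in> C" using z E(2) hom[of _ z "1 / real (Suc n)"]
      by (auto simp: w_def C_def cone_def)
    moreover have "norm w \<le> 1" using n by (simp add: w_def)
    moreover have "z = real (Suc n) *\<^sub>R w" by (simp add: w_def)
    ultimately have "z \<in> (\<lambda>z. real (Suc n) *\<^sub>R z) ` (C \<inter> cball 0 1)"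
      by (intro image_eqI) auto
    then show "z \<in> (\<Union>n::nat. (\<lambda>z. real (Suc n) *\<^sub>R z) ` (C \<inter> cball 0 1))" by blast
  qed
  moreover have "negligible (\<Union>n::nat. (\<lambda>z. real (Suc n) *\<^sub>R z) ` (C \<inter> cball 0 1))"
    using neg by (intro negligible_countable_Union countable_image)
       (auto intro!: negligible_differentiable_image_negligible derivative_intros)
  ultimately have "negligible C" using negligible_subset by blast
  then have "negligible (insert 0 C)" by simp
  moreover have "{z \<in> E. \<forall>j\<in>J. 1 \<le> h j z} \<subseteq> insert 0 C"
    by (auto simp: C_def intro: less_le_trans[OF zero_less_one])
  ultimately have "negligible {z \<in> E. \<forall>j\<in>J. 1 \<le> h j z}" using negligible_subset by blast
  then show False using leb by (simp add: negligible_iff_null_sets null_setsD1)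
qed

section \<open>Asymptotically homogeneous losses\<close>

context
  fixes E :: "'a::euclidean_space set" and l ls :: "'a \<Rightarrow> real"
  assumes conv: "\<And>\<zeta> z. (\<And>t. \<zeta> t \<in> E) \<Longrightarrow> z \<in> E \<Longrightarrow> (\<zeta> \<longlongrightarrow> z) at_top \<Longrightarrow>
           ((\<lambda>t::real. inverse t * l (t *\<^sub>R \<zeta> t)) \<longlongrightarrow> ls z) at_top"
begin

text \<open>Convergence along every path forces uniformity near each point. Otherwise points with
  error at least \<open>e\<close> exist arbitrarily close to \<open>z\<close> at arbitrarily late
  times, and they can be threaded into one path that tends to \<open>z\<close> while the scaled
  losses along it do not tend to \<open>ls z\<close>.\<close>

lemma locally_uniform_limit_if_continuous_convergence:
  assumes z: "z \<in> E" and e: "0 < e"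
  shows "\<exists>\<eta>>0. \<forall>\<^sub>F t in at_top. \<forall>w\<in>E \<inter> ball z \<eta>. \<bar>inverse t * l (t *\<^sub>R w) - ls z\<bar> < e"
proof (rule ccontr)
  define bad where "bad t w \<longleftrightarrow> w \<in> E \<and> \<not> \<bar>inverse t * l (t *\<^sub>R w) - ls z\<bar> < e" for t w
  assume neg: "\<not> ?thesis"
  then have ex: "\<exists>t w. T < t \<and> bad t w \<and> dist z w < \<eta>" if "0 < \<eta>" for \<eta> T
  proof -
    have "\<not> (\<forall>\<^sub>F t in at_top. \<forall>w\<in>E \<inter> ball z \<eta>. \<bar>inverse t * l (t *\<^sub>R w) - ls z\<bar> < e)"
      using neg that by blast
    then obtain t w where "T < t" "w \<in> E \<inter> ball z \<eta>" "\<not> \<bar>inverse t * l (t *\<^sub>R w) - ls z\<bar> < e"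
      unfolding eventually_at_top_dense by blast
    then show ?thesis unfolding bad_def by auto
  qed
  \<comment> \<open>Each pair holds a time and a bad point. The times exceed \<open>n\<close>, hence
    diverge, and strictly increase, hence determine the index; the points approach
    \<open>z\<close>.\<close>
  have "\<exists>x. \<forall>n. (real n < fst (x n) \<and> bad (fst (x n)) (snd (x n)) \<and>
           dist z (snd (x n)) < 1 / real (Suc n)) \<and> fst (x n) < fst (x (Suc n))"
  proof (rule dependent_nat_choice)
    show "\<exists>x. real 0 < fst x \<and> bad (fst x) (snd x) \<and> dist z (snd x) < 1 / real (Suc 0)"
      using ex[of 1 0] by auto
    fix x :: "real \<times> 'a" and n
    show "\<exists>y. (real (Suc n) < fst y \<and> bad (fst y) (snd y) \<and>
           dist z (snd y) < 1 / real (Suc (Suc n))) \<and> fst x < fst y"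
      using ex[of "1 / real (Suc (Suc n))" "max (fst x) (real (Suc n))"] by auto
  qed
  then obtain x where x: "\<And>n. real n < fst (x n)" "\<And>n. bad (fst (x n)) (snd (x n))"
      "\<And>n. dist z (snd (x n)) < 1 / real (Suc n)" "\<And>n. fst (x n) < fst (x (Suc n))" by blast
  define t where "t n = fst (x n)" for n
  have t: "strict_mono t" using x(4) by (simp add: strict_mono_Suc_iff t_def)
  then have "inj t" by (rule strict_mono_imp_inj_on)
  \<comment> \<open>The path must be defined at all real times: it visits the bad points at the
    chosen times and rests at \<open>z\<close> otherwise.\<close>
  define \<zeta> where "\<zeta> r = (if r \<in> range t then snd (x (inv t r)) else z)" for r
  have \<zeta>t: "\<zeta> (t n) = snd (x n)" for n using \<open>inj t\<close> by (simp add: \<zeta>_def)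
  have "\<zeta> r \<in> E" for r using x(2) z by (auto simp: \<zeta>_def bad_def)
  moreover have "(\<zeta> \<longlongrightarrow> z) at_top"
  proof (rule tendstoI)
    fix \<epsilon> :: real assume "0 < \<epsilon>"
    then obtain N where N: "1 / real (Suc N) < \<epsilon>" using nat_approx_posE by blast
    have "dist (\<zeta> r) z < \<epsilon>" if r: "t N \<le> r" for r
    proof (cases "r \<in> range t")
      case True
      then obtain n where n: "r = t n" by auto
      then have "N \<le> n" using r t by (simp add: strict_mono_less_eq)
      then have "1 / real (Suc n) \<le> 1 / real (Suc N)" by (simp add: frac_le)
      then show ?thesis using x(3)[of n] N n by (simp add: \<zeta>t dist_commute)
    qed (use \<open>0 < \<epsilon>\<close> in \<open>simp add: \<zeta>_def\<close>)
    then show "\<forall>\<^sub>F r in at_top. dist (\<zeta> r) z < \<epsilon>"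
      by (auto simp: eventually_at_top_linorder)
  qed
  ultimately have lim: "((\<lambda>t. inverse t * l (t *\<^sub>R \<zeta> t)) \<longlongrightarrow> ls z) at_top" by (intro conv z)
  have "filterlim t at_top sequentially"
    using filterlim_real_sequentially
    by (rule filterlim_at_top_mono) (use x(1) in \<open>auto simp: t_def less_imp_le\<close>)
  from tendstoD[OF filterlim_compose[OF lim this] e] obtain n
    where "dist (inverse (t n) * l (t n *\<^sub>R \<zeta> (t n))) (ls z) < e"
    by (auto simp: eventually_sequentially)
  then show False using x(2)[of n] by (simp add: bad_def t_def[symmetric] \<zeta>t dist_real_def)
qed

text \<open>One ball serves both estimates: the limit \<open>ls w\<close> along the constant path at
  \<open>w\<close> inherits the bound for the scaled losses, with the strict inequality
  weakened.\<close>

lemma asymptotic_loss_near: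
  assumes z: "z \<in> E" and e: "0 < e"
  shows "\<exists>\<eta>>0. (\<forall>w\<in>E \<inter> ball z \<eta>. \<bar>ls w - ls z\<bar> \<le> e) \<and>
           (\<forall>\<^sub>F t in at_top. \<forall>w\<in>E \<inter> ball z \<eta>. \<bar>inverse t * l (t *\<^sub>R w) - ls z\<bar> < e)"
proof -
  obtain \<eta> where \<eta>: "\<eta> > 0"
      "\<forall>\<^sub>F t in at_top. \<forall>w\<in>E \<inter> ball z \<eta>. \<bar>inverse t * l (t *\<^sub>R w) - ls z\<bar> < e"
    using locally_uniform_limit_if_continuous_convergence[OF z e] by blast
  have "\<bar>ls w - ls z\<bar> \<le> e" if w: "w \<in> E \<inter> ball z \<eta>" for w
  proof (rule tendsto_upperbound)
    have "((\<lambda>t. inverse t * l (t *\<^sub>R w)) \<longlongrightarrow> ls w) at_top" using w by (intro conv) auto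
    then show "((\<lambda>t. \<bar>inverse t * l (t *\<^sub>R w) - ls z\<bar>) \<longlongrightarrow> \<bar>ls w - ls z\<bar>) at_top"
      by (intro tendsto_intros)
    show "\<forall>\<^sub>F t in at_top. \<bar>inverse t * l (t *\<^sub>R w) - ls z\<bar> \<le> e"
      using \<eta>(2) by eventually_elim (use w less_imp_le in blast)
  qed simp
  with \<eta> show ?thesis by blast
qed

lemma continuous_on_asymptotic_loss: "continuous_on E ls"
  unfolding continuous_on_iff
proof (intro ballI allI impI)
  fix z and e :: real assume "z \<in> E" "0 < e"
  then obtain \<eta> where "\<eta> > 0" "\<forall>w\<in>E \<inter> ball z \<eta>. \<bar>ls w - ls z\<bar> \<le> e / 2"
    using asymptotic_loss_near[of z "e / 2"] by auto
  then show "\<exists>d>0. \<forall>w\<in>E. dist w z < d \<longrightarrow> dist (ls w) (ls z) < e"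
  proof (intro exI[of _ \<eta>] conjI ballI impI)
    fix w assume "w \<in> E" "dist w z < \<eta>"
    then have "\<bar>ls w - ls z\<bar> \<le> e / 2"
      using \<open>\<forall>w\<in>E \<inter> ball z \<eta>. \<bar>ls w - ls z\<bar> \<le> e / 2\<close> by (simp add: dist_commute)
    then show "dist (ls w) (ls z) < e" using \<open>0 < e\<close> by (simp add: dist_real_def)
  qed (rule \<open>\<eta> > 0\<close>)
qed

text \<open>A finite subcover by balls of local control reduces uniformity to finitely many eventual
  bounds; comparison with the ball centre costs \<open>e / 2\<close> for the scaled loss and
  \<open>e / 2\<close> for its limit.\<close>

lemma asymptotic_loss_uniform_on_compact:
  assumes C: "compact C" "C \<subseteq> E" and e: "0 < e"
  shows "\<forall>\<^sub>F t in at_top. \<forall>w\<in>C. \<bar>inverse t * l (t *\<^sub>R w) - ls w\<bar> < e"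
proof -
  have "\<forall>z\<in>C. \<exists>\<eta>. \<eta> > 0 \<and> (\<forall>w\<in>E \<inter> ball z \<eta>. \<bar>ls w - ls z\<bar> \<le> e / 2) \<and>
           (\<forall>\<^sub>F t in at_top. \<forall>w\<in>E \<inter> ball z \<eta>. \<bar>inverse t * l (t *\<^sub>R w) - ls z\<bar> < e / 2)"
    using C e by (intro ballI asymptotic_loss_near) auto
  from bchoice[OF this] obtain \<eta> where \<eta>: "\<And>z. z \<in> C \<Longrightarrow> 0 < \<eta> z"
    "\<And>z w. z \<in> C \<Longrightarrow> w \<in> E \<inter> ball z (\<eta> z) \<Longrightarrow> \<bar>ls w - ls z\<bar> \<le> e / 2"
    "\<And>z. z \<in> C \<Longrightarrow> \<forall>\<^sub>F t in at_top. \<forall>w\<in>E \<inter> ball z (\<eta> z). \<bar>inverse t * l (t *\<^sub>R w) - ls z\<bar> < e / 2"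
    by blast
  have "C \<subseteq> (\<Union>z\<in>C. ball z (\<eta> z))" using \<eta>(1) by auto
  then obtain D where D: "D \<subseteq> C" "finite D" "C \<subseteq> (\<Union>z\<in>D. ball z (\<eta> z))"
    by (rule compactE_image[OF C(1) open_ball])
  have "\<forall>\<^sub>F t in at_top. \<forall>z\<in>D. \<forall>w\<in>E \<inter> ball z (\<eta> z). \<bar>inverse t * l (t *\<^sub>R w) - ls z\<bar> < e / 2"
    using \<eta>(3) D by (intro eventually_ball_finite) auto
  then show ?thesis
  proof eventually_elim
    fix t assume t: "\<forall>z\<in>D. \<forall>w\<in>E \<inter> ball z (\<eta> z). \<bar>inverse t * l (t *\<^sub>R w) - ls z\<bar> < e / 2"
    show "\<forall>w\<in>C. \<bar>inverse t * l (t *\<^sub>R w) - ls w\<bar> < e"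
    proof
      fix w assume w: "w \<in> C"
      then obtain z where z: "z \<in> D" "w \<in> E \<inter> ball z (\<eta> z)" using D C by blast
      have "\<bar>ls w - ls z\<bar> \<le> e / 2" using \<eta>(2)[of z w] z D by blast
      moreover have "\<bar>inverse t * l (t *\<^sub>R w) - ls z\<bar> < e / 2" using t z by blast
      ultimately show "\<bar>inverse t * l (t *\<^sub>R w) - ls w\<bar> < e" by linarith
    qed
  qed
qed

text \<open>Replacing \<open>t\<close> by \<open>t * c\<close> along the constant path at
  \<open>z\<close> gives the scaled loss at \<open>c *\<^sub>R z\<close> up to the factor
  \<open>c\<close>, and limits are unique.\<close>

lemma asymptotic_loss_scaleR:
  assumes "cone E" and z: "z \<in> E" and c: "0 < c"
  shows "ls (c *\<^sub>R z) = c * ls z"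
proof (rule tendsto_unique)
  have "c *\<^sub>R z \<in> E" using assms by (simp add: cone_def)
  then show "((\<lambda>t. inverse t * l (t *\<^sub>R (c *\<^sub>R z))) \<longlongrightarrow> ls (c *\<^sub>R z)) at_top"
    by (intro conv) auto
  have "((\<lambda>t. inverse t * l (t *\<^sub>R z)) \<longlongrightarrow> ls z) at_top" using z by (intro conv) auto
  then have "((\<lambda>t. inverse (t * c) * l ((t * c) *\<^sub>R z)) \<longlongrightarrow> ls z) at_top"
    by (rule filterlim_compose)
       (intro filterlim_at_top_mult_tendsto_pos[OF tendsto_const c] filterlim_ident)
  then have "((\<lambda>t. c * (inverse (t * c) * l ((t * c) *\<^sub>R z))) \<longlongrightarrow> c * ls z) at_top"
    by (intro tendsto_intros)
  also have "(\<lambda>t. c * (inverse (t * c) * l ((t * c) *\<^sub>R z))) = (\<lambda>t. inverse t * l (t *\<^sub>R (c *\<^sub>R z)))"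
    using c by (auto simp: fun_eq_iff)
  finally show "((\<lambda>t. inverse t * l (t *\<^sub>R (c *\<^sub>R z))) \<longlongrightarrow> c * ls z) at_top" .
qed simp

text \<open>Along the constant path at the origin the loss is a fixed number divided by
  \<open>t\<close>. The value 0 keeps the origin out of the limit exceedance set.\<close>

lemma asymptotic_loss_zero:
  assumes "0 \<in> E" shows "ls 0 = 0"
proof (rule tendsto_unique)
  show "((\<lambda>t. inverse t * l (t *\<^sub>R 0)) \<longlongrightarrow> ls 0) at_top" using assms by (intro conv) auto
  have "((\<lambda>t. inverse t * l 0) \<longlongrightarrow> 0 * l 0) at_top"
    by (intro tendsto_intros tendsto_inverse_0_at_top filterlim_ident)
  then show "((\<lambda>t. inverse t * l (t *\<^sub>R 0)) \<longlongrightarrow> 0) at_top" by simp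
qed simp

end

text \<open>A frontier point is approached both from \<open>B\<close> and from \<open>X - B\<close>,
  which is impossible where membership in \<open>B\<close> is locally constant. This encloses
  relative frontiers in unions of level sets.\<close>

lemma frontier_of_subset_if_locally_constant:
  fixes X :: "'a::metric_space set"
  assumes "\<And>z. z \<in> X - N \<Longrightarrow> \<forall>\<^sub>F w in at z within X. w \<in> B \<longleftrightarrow> z \<in> B" and "B \<subseteq> X"
  shows "top_of_set X frontier_of B \<subseteq> N"
proof
  fix z assume z: "z \<in> top_of_set X frontier_of B"
  then have zX: "z \<in> X" using frontier_of_subset_topspace by fastforce
  show "z \<in> N"
  proof (rule ccontr)
    assume "z \<notin> N"
    then obtain U where U: "open U" "z \<in> U" "\<And>w. w \<in> U \<Longrightarrow> w \<noteq> z \<Longrightarrow> w \<in> X \<Longrightarrow> w \<in> B \<longleftrightarrow> z \<in> B"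
      using assms(1)[of z] zX unfolding eventually_at_topological by blast
    have V: "z \<in> X \<inter> U \<and> openin (top_of_set X) (X \<inter> U)" using U zX by (simp add: openin_open_Int)
    have "z \<in> top_of_set X closure_of B" "z \<in> top_of_set X closure_of (X - B)"
      using z by (auto simp: frontier_of_closures)
    then have "\<exists>y. y \<in> B \<and> y \<in> X \<inter> U" "\<exists>y. y \<in> X - B \<and> y \<in> X \<inter> U"
      using V unfolding in_closure_of by (metis, metis)
    then show False using U(3) by (metis DiffD2 IntD1 IntD2)
  qed
qed

section \<open>Weak convergence and tail preservation\<close>

text \<open>Pushing forward along a test function \<open>g\<close> turns the claim into weak
  convergence of real distributions, whose distribution functions are the masses of the sets
  \<open>{g \<le> t}\<close>. A continuity point \<open>t\<close> of the limiting distribution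
  function is one with \<open>{g = t}\<close> null.\<close>

lemma weakly_convergesI_sublevel:
  fixes \<mu> :: "real \<Rightarrow> 'a::euclidean_space measure"
  assumes ev: "\<forall>\<^sub>F u in at_top. sets (\<mu> u) = sets borel \<and> prob_space (\<mu> u)"
    and \<nu>: "sets \<nu> = sets borel" "prob_space \<nu>"
    and lim: "\<And>(g :: 'a \<Rightarrow> real) t. continuous_on UNIV g \<Longrightarrow> measure \<nu> {z. g z = t} = 0 \<Longrightarrow>
      ((\<lambda>u. measure (\<mu> u) {z. g z \<le> t}) \<longlongrightarrow> measure \<nu> {z. g z \<le> t}) at_top"
  shows "weakly_converges \<mu> \<nu> at_top"
  unfolding weakly_converges_def
proof (intro conjI allI impI ev \<nu>)
  fix g :: "'a \<Rightarrow> real"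
  assume g: "continuous_on UNIV g \<and> bounded (range g)"
  then obtain B where B: "\<And>z. \<bar>g z\<bar> \<le> B" by (auto simp: bounded_iff)
  have [measurable]: "g \<in> borel_measurable borel" using g borel_measurable_continuous_onI by blast
  define good where "good m \<longleftrightarrow> sets m = sets borel \<and> prob_space m" for m :: "'a measure"
  have gm: "g \<in> borel_measurable k" if "good k" for k
    using that by (simp add: good_def measurable_cong_sets[of k borel])
  \<comment> \<open>The identity on the line is unbounded; its truncation to \<open>[-B, B]\<close>
    is bounded and agrees with it on the range of \<open>g\<close>.\<close>
  define c where "c x = max (- B) (min B x)" for x :: real
  have c_cont: "isCont c x" for x unfolding c_def by (intro continuous_intros)
  have cg: "c (g z) = g z" for z using B[of z] by (auto simp: c_def)
  have c_int: "(\<integral>x. c x \<partial>distr k borel g) = (\<integral>z. g z \<partial>k)" if "good k" for k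
    using integral_distr[OF gm[OF that], of c] c_cont
    by (simp add: cg borel_measurable_continuous_onI continuous_at_imp_continuous_on)
  show "((\<lambda>u. \<integral>z. g z \<partial>\<mu> u) \<longlongrightarrow> (\<integral>z. g z \<partial>\<nu>)) at_top"
  proof (rule tendsto_at_topI_sequentially)
    fix X :: "nat \<Rightarrow> real" assume X: "filterlim X at_top sequentially"
    \<comment> \<open>The measures are probabilities only eventually, while the theorem on the real
      line wants every term of the sequence to be one, so exceptional terms are replaced by
      \<open>\<nu>\<close>.\<close>
    define m where "m n = (if good (\<mu> (X n)) then \<mu> (X n) else \<nu>)" for n
    have good_m: "good (m n)" for n using \<nu> by (simp add: m_def good_def)
    have m_eq: "\<forall>\<^sub>F n in sequentially. m n = \<mu> (X n)"
      using filterlim_iff[THEN iffD1, OF X, rule_format, OF ev]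
      by eventually_elim (simp add: m_def good_def)
    have rd: "real_distribution (distr k borel g)" if "good k" for k
      using that gm by (simp add: good_def prob_space.real_distribution_distr)
    have cdf: "cdf (distr k borel g) t = measure k {z. g z \<le> t}" if "good k" for k t
      using that sets_eq_imp_space_eq[of k borel] measure_distr[OF gm[OF that], of "{..t}"]
      by (simp add: good_def cdf_def vimage_def)
    have good_\<nu>: "good \<nu>" using \<nu> by (simp add: good_def)
    interpret N: real_distribution "distr \<nu> borel g" by (rule rd[OF good_\<nu>])
    have wc: "weak_conv_m (\<lambda>n. distr (m n) borel g) (distr \<nu> borel g)"
      unfolding weak_conv_m_def weak_conv_def
    proof (intro allI impI)
      fix t assume "isCont (cdf (distr \<nu> borel g)) t"
      then have "measure (distr \<nu> borel g) {t} = 0" by (simp add: N.isCont_cdf)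
      then have "measure \<nu> {z. g z = t} = 0"
        using sets_eq_imp_space_eq[OF \<nu>(1)] measure_distr[OF gm[OF good_\<nu>], of "{t}"]
        by (simp add: vimage_def)
      then have "(\<lambda>n. measure (\<mu> (X n)) {z. g z \<le> t}) \<longlonglongrightarrow> measure \<nu> {z. g z \<le> t}"
        using filterlim_compose[OF lim X] g by simp
      then have "(\<lambda>n. measure (m n) {z. g z \<le> t}) \<longlonglongrightarrow> measure \<nu> {z. g z \<le> t}"
        by (rule Lim_transform_eventually) (use m_eq in eventually_elim, simp)
      then show "(\<lambda>n. cdf (distr (m n) borel g) t) \<longlonglongrightarrow> cdf (distr \<nu> borel g) t"
        by (simp add: cdf good_m good_\<nu>)
    qed
    have cB: "norm (c x) \<le> B" for x using B[of undefined] by (auto simp: c_def)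
    have "(\<lambda>n. \<integral>x. c x \<partial>distr (m n) borel g) \<longlonglongrightarrow> (\<integral>x. c x \<partial>distr \<nu> borel g)"
      by (rule weak_conv_imp_integral_bdd_continuous_conv
            [OF rd[OF good_m] rd[OF good_\<nu>] wc c_cont cB])
    then have "(\<lambda>n. \<integral>z. g z \<partial>m n) \<longlonglongrightarrow> (\<integral>z. g z \<partial>\<nu>)"
      by (simp add: c_int good_m good_\<nu>)
    then show "(\<lambda>n. \<integral>z. g z \<partial>\<mu> (X n)) \<longlonglongrightarrow> (\<integral>z. g z \<partial>\<nu>)"
      by (rule Lim_transform_eventually) (use m_eq in eventually_elim, simp)
  qed
qed

section \<open>Sets bounded away from the origin\<close>

lemma emeasure_M0_finite:
  fixes E :: "'a::euclidean_space set"
  assumes \<nu>: "\<nu> \<in> M0 E" and "closed E" and B: "B \<subseteq> E - {0}" "0 \<notin> closure B"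
  shows "emeasure \<nu> B < \<infinity>"
proof -
  obtain r where r: "r > 0" "\<And>z. z \<in> B \<Longrightarrow> r < norm z"
  proof -
    obtain e where "e > 0" "\<And>z. z \<in> B \<Longrightarrow> e \<le> norm z"
      using B(2) by (auto simp: closure_approachable not_less)
    then show ?thesis by (intro that[of "e / 2"]) force+
  qed
  have "(E - {0}) \<inter> {z. r < norm z} \<in> sets borel"
    using \<open>closed E\<close> by measurable
  then have "{z \<in> E - {0}. r < norm z} \<in> sets \<nu>"
    using \<nu> \<open>closed E\<close> by (auto simp: M0_def sets_restrict_space_iff Int_def)
  then have "emeasure \<nu> B \<le> emeasure \<nu> {z \<in> E - {0}. r < norm z}"
    using r B by (intro emeasure_mono) auto
  also have "\<dots> < \<infinity>" using \<nu> r by (simp add: M0_def)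
  finally show ?thesis .
qed

text \<open>The converging measures are scaled and restricted to \<open>E - {0}\<close>; for
  \<open>B\<close> inside that space their values are plain scaled probabilities, and finiteness of
  the limit allows passing from extended to real values.\<close>

lemma tail_preserving_tendsto:
  fixes E :: "'a::euclidean_space set"
  assumes "prob_space M" and E: "closed E" and tp: "tail_preserving M E s \<nu> X"
    and B: "B \<in> sets borel" "B \<subseteq> E - {0}" "0 \<notin> closure B"
    and fr: "emeasure \<nu> (top_of_set (E - {0}) frontier_of B) = 0"
  shows "((\<lambda>u. u powr s * measure M {\<omega> \<in> space M. X u \<omega> /\<^sub>R u \<in> B}) \<longlongrightarrow> measure \<nu> B) at_top"
proof -
  interpret prob_space M by fact
  have \<nu>: "\<nu> \<in> M0 E" using tp by (simp add: tail_preserving_def M0_tendsto_def)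
  have "((\<lambda>u. emeasure (scale_measure (ennreal (u powr s))
              (restrict_space (distr M borel (\<lambda>\<omega>. X u \<omega> /\<^sub>R u)) (E - {0}))) B)
          \<longlongrightarrow> emeasure \<nu> B) at_top"
    using tp B fr by (simp add: tail_preserving_def M0_tendsto_def)
  then have "((\<lambda>u. ennreal (u powr s * measure M {\<omega> \<in> space M. X u \<omega> /\<^sub>R u \<in> B}))
          \<longlongrightarrow> emeasure \<nu> B) at_top"
  proof (rule Lim_transform_eventually)
    show "\<forall>\<^sub>F u in at_top. emeasure (scale_measure (ennreal (u powr s))
              (restrict_space (distr M borel (\<lambda>\<omega>. X u \<omega> /\<^sub>R u)) (E - {0}))) B =
            ennreal (u powr s * measure M {\<omega> \<in> space M. X u \<omega> /\<^sub>R u \<in> B})"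
      using eventually_gt_at_top[of 0]
    proof eventually_elim
      fix u :: real assume "0 < u"
      then have [measurable]: "X u \<in> borel_measurable M" using tp by (simp add: tail_preserving_def)
      have "E - {0} \<in> sets borel" using E by auto
      then have "emeasure (restrict_space (distr M borel (\<lambda>\<omega>. X u \<omega> /\<^sub>R u)) (E - {0})) B
        = emeasure M ((\<lambda>\<omega>. X u \<omega> /\<^sub>R u) -` B \<inter> space M)"
        using B by (subst emeasure_restrict_space) (auto intro!: emeasure_distr)
      then show "emeasure (scale_measure (ennreal (u powr s))
              (restrict_space (distr M borel (\<lambda>\<omega>. X u \<omega> /\<^sub>R u)) (E - {0}))) B =
            ennreal (u powr s * measure M {\<omega> \<in> space M. X u \<omega> /\<^sub>R u \<in> B})"
        by (simp add: emeasure_eq_measure ennreal_mult vimage_def Int_def conj_commute)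
    qed
  qed
  moreover have "emeasure \<nu> B = ennreal (measure \<nu> B)"
    using emeasure_M0_finite[OF \<nu> E B(2,3)] by (intro emeasure_eq_ennreal_measure) auto
  ultimately show ?thesis by simp
qed

section \<open>Limits of scaled exceedance probabilities\<close>

lemma (in finite_measure) abs_measure_diff_le:
  assumes "A \<in> sets M" "B \<in> sets M" "C \<in> sets M" "A \<subseteq> B \<union> C" "B \<subseteq> A \<union> C"
  shows "\<bar>measure M A - measure M B\<bar> \<le> measure M C"
proof -
  have "measure M A \<le> measure M (B \<union> C)" "measure M B \<le> measure M (A \<union> C)"
    using assms by (auto intro!: finite_measure_mono)
  moreover have "measure M (B \<union> C) \<le> measure M B + measure M C"
    "measure M (A \<union> C) \<le> measure M A + measure M C"
    using assms by (auto intro!: measure_Un_le)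
  ultimately show ?thesis by linarith
qed

text \<open>The condition on \<open>g\<close> is carried along so that one limit yields both parts
  of the conditional quotient: the numerator for a test function, the denominator for a constant
  one. The polar form of the tail measure enters only through \<open>level\<close>.\<close>

lemma scaled_exceedance_tendsto:
  fixes E :: "'a::euclidean_space set" and l ls :: "'j \<Rightarrow> 'a \<Rightarrow> real"
  assumes M: "prob_space M" and E: "closed E" "cone E"
    and tp: "tail_preserving M E s \<nu> X"
    and level: "\<And>h a. continuous_on E h \<Longrightarrow> (\<And>z c. z \<in> E \<Longrightarrow> 0 < c \<Longrightarrow> h (c *\<^sub>R z) = c * h z) \<Longrightarrow>
      a \<noteq> 0 \<Longrightarrow> emeasure \<nu> {z \<in> E - {0}. h z = a} = 0"
    and J: "finite J" "J \<noteq> {}"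
    and lm: "\<And>j. j \<in> J \<Longrightarrow> l j \<in> borel_measurable (restrict_space borel E)"
    and conv: "\<And>j \<zeta> z. j \<in> J \<Longrightarrow> (\<And>t. \<zeta> t \<in> E) \<Longrightarrow> z \<in> E \<Longrightarrow> (\<zeta> \<longlongrightarrow> z) at_top \<Longrightarrow>
           ((\<lambda>t::real. inverse t * l j (t *\<^sub>R \<zeta> t)) \<longlongrightarrow> ls j z) at_top"
    and g: "continuous_on UNIV g"
    and S: "S = {z \<in> E. \<forall>j\<in>J. 1 \<le> ls j z}"
    and gt: "emeasure \<nu> (S \<inter> {z. g z = t}) = 0"
  shows "((\<lambda>u. u powr s * measure M {\<omega> \<in> space M. X u \<omega> \<in> {z \<in> E. \<forall>j\<in>J. u \<le> l j z} \<and>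
              g (X u \<omega> /\<^sub>R u) \<le> t})
          \<longlongrightarrow> measure \<nu> (S \<inter> {z. g z \<le> (t::real)})) at_top"
proof -
  interpret prob_space M by fact
  have \<nu>: "\<nu> \<in> M0 E" using tp by (simp add: tail_preserving_def M0_tendsto_def)
  have sets_\<nu>: "sets \<nu> = sets (restrict_space borel (E - {0}))" using \<nu> by (simp add: M0_def)
  have E_Diff: "E - {0} \<in> sets borel" using E by auto
  have in_\<nu>: "B \<in> sets \<nu> \<longleftrightarrow> B \<in> sets borel \<and> B \<subseteq> E - {0}" for B
    using E_Diff by (auto simp: sets_\<nu> sets_restrict_space_iff)
  have cont: "continuous_on E (ls j)" if "j \<in> J" for j
    by (rule continuous_on_asymptotic_loss[of E "l j"]) (rule conv[OF that])
  have hom: "ls j (c *\<^sub>R z) = c * ls j z" if "j \<in> J" "z \<in> E" "0 < c" for j z c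
    by (rule asymptotic_loss_scaleR[of E "l j", OF _ E(2) that(2,3)]) (rule conv[OF that(1)])
  have zero: "ls j 0 = 0" if "j \<in> J" "0 \<in> E" for j
    by (rule asymptotic_loss_zero[of E "l j", OF _ that(2)]) (rule conv[OF that(1)])
  define p where "p u B = u powr s * measure M {\<omega> \<in> space M. X u \<omega> /\<^sub>R u \<in> B}" for u B
  define A where "A = {z. g z \<le> t}"
  define N1 where "N1 = (\<Union>j\<in>J. {z \<in> E - {0}. ls j z = 1})"
  \<comment> \<open>\<open>W n\<close> holds the points where an error below
    \<open>1 / (n + 2)\<close> could change the truth of \<open>1 \<le> ls j z\<close>, together
    with those of norm at least \<open>n + 1\<close>, where no uniform error bound is used. Since
    \<open>1 / (n + 2) < 1\<close> and \<open>ls j 0 = 0\<close>, it stays away from the origin, and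
    the levels \<open>1 - 1 / (n + 2)\<close> on its border are nonzero.\<close>
  define W where "W n = {z \<in> E - {0}. real (Suc n) \<le> norm z \<or> (\<exists>j\<in>J. \<bar>ls j z - 1\<bar> \<le> 1 / real (n + 2))}" for n
  have W_closed: "closed {z \<in> E. real (Suc n) \<le> norm z \<or> (\<exists>j\<in>J. \<bar>ls j z - 1\<bar> \<le> 1 / real (n + 2))}" for n
  proof -
    have "closed (E \<inter> {z. real (Suc n) \<le> norm z} \<union>
        (\<Union>j\<in>J. E \<inter> (\<lambda>z. \<bar>ls j z - 1\<bar>) -` {..1 / real (n + 2)}))"
      using J E(1) cont
      by (intro closed_Un closed_Int closed_UN ballI continuous_closed_preimage
            closed_Collect_le continuous_intros) auto
    also have "\<dots> = {z \<in> E. real (Suc n) \<le> norm z \<or> (\<exists>j\<in>J. \<bar>ls j z - 1\<bar> \<le> 1 / real (n + 2))}"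
      by auto
    finally show ?thesis .
  qed
  have W_eq: "W n = {z \<in> E. real (Suc n) \<le> norm z \<or> (\<exists>j\<in>J. \<bar>ls j z - 1\<bar> \<le> 1 / real (n + 2))}" for n
    using zero by (auto simp: W_def)
  have S_closed: "closed S"
    unfolding S using E(1) cont by (rule closed_superlevel)
  have S0: "0 \<notin> S" using zero J by (auto simp: S)
  have A_closed: "closed A" unfolding A_def using g by (intro closed_Collect_le) auto
  have SA: "S \<inter> A \<in> sets borel" "S \<inter> A \<subseteq> E - {0}" "0 \<notin> closure (S \<inter> A)"
  proof -
    have cl: "closed (S \<inter> A)" using S_closed A_closed by (rule closed_Int)
    show "S \<inter> A \<in> sets borel" using cl by (rule borel_closed)
    show "S \<inter> A \<subseteq> E - {0}" using S0 by (auto simp: S)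
    show "0 \<notin> closure (S \<inter> A)" using S0 by (simp add: closure_closed[OF cl])
  qed
  have W: "W n \<in> sets borel" "W n \<subseteq> E - {0}" "0 \<notin> closure (W n)" for n
  proof -
    have cl: "closed (W n)" using W_closed[of n] by (simp add: W_eq)
    show "W n \<in> sets borel" using cl by (rule borel_closed)
    show sub: "W n \<subseteq> E - {0}" by (auto simp: W_def)
    show "0 \<notin> closure (W n)" using sub by (auto simp: closure_closed[OF cl])
  qed
  have ev_E: "\<forall>\<^sub>F w in at z within E - {0}. w \<in> E - {0}" for z
    by (auto simp: eventually_at_filter)
  have ev_lt: "\<forall>\<^sub>F w in at z within E - {0}. h w < a"
    and ev_gt: "\<forall>\<^sub>F w in at z within E - {0}. b < h w"
    if "continuous_on E h" "z \<in> E - {0}" "h z < a" "b < h z" for h :: "'a \<Rightarrow> real" and z a b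
    using that order_tendstoD[of h "h z" "at z within E - {0}"] continuous_on_subset[of E h "E - {0}"]
    by (auto simp: continuous_on_def)
  have side: "\<forall>\<^sub>F w in at z within E - {0}. a \<le> h w \<longleftrightarrow> a \<le> h z"
    if h: "continuous_on E h" "z \<in> E - {0}" "h z \<noteq> a" for h :: "'a \<Rightarrow> real" and z a
  proof (cases "a \<le> h z")
    case True
    with h(3) have "a < h z" by simp
    from ev_gt[OF h(1,2) _ this, of "h z + 1"] True show ?thesis by (auto elim: eventually_mono)
  next
    case False
    from ev_lt[OF h(1,2), of a "h z - 1"] False show ?thesis by (auto elim: eventually_mono)
  qed
  have null_sub: "emeasure \<nu> B = 0" if "B \<subseteq> N" "N \<in> null_sets \<nu>" for B N
    using emeasure_mono[OF that(1) null_setsD2[OF that(2)]] null_setsD1[OF that(2)] by simp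
  have null: "{z \<in> E - {0}. h z = a} \<in> null_sets \<nu>"
    if h: "continuous_on E h" "\<And>z c. z \<in> E \<Longrightarrow> 0 < c \<Longrightarrow> h (c *\<^sub>R z) = c * h z" "a \<noteq> 0" for h a
  proof (rule null_setsI)
    show "emeasure \<nu> {z \<in> E - {0}. h z = a} = 0" using h by (rule level)
    have "closed {z \<in> E. h z = a}"
      using continuous_closed_preimage_constant[OF h(1) E(1)] by simp
    then have "{z \<in> E. h z = a} - {0} \<in> sets borel" by auto
    also have "{z \<in> E. h z = a} - {0} = {z \<in> E - {0}. h z = a}" by auto
    finally show "{z \<in> E - {0}. h z = a} \<in> sets \<nu>" by (auto simp: in_\<nu>)
  qed
  have null_ls: "{z \<in> E - {0}. ls j z = a} \<in> null_sets \<nu>" if "j \<in> J" "a \<noteq> 0" for j a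
    by (rule null[OF cont[OF that(1)] hom[OF that(1)] that(2)])
  have N1_null: "N1 \<in> null_sets \<nu>"
    unfolding N1_def using J(1) by (intro null_sets_UN' null_ls countable_finite) auto
  have frS: "emeasure \<nu> (top_of_set (E - {0}) frontier_of (S \<inter> A)) = 0"
  proof -
    have "top_of_set (E - {0}) frontier_of (S \<inter> A) \<subseteq> N1 \<union> (S \<inter> {z. g z = t})"
    proof (rule frontier_of_subset_if_locally_constant)
      fix z assume z: "z \<in> E - {0} - (N1 \<union> S \<inter> {z. g z = t})"
      have "\<forall>\<^sub>F w in at z within E - {0}. \<forall>j\<in>J. 1 \<le> ls j w \<longleftrightarrow> 1 \<le> ls j z"
        using z J cont by (intro eventually_ball_finite ballI side) (auto simp: N1_def)
      then have 1: "\<forall>\<^sub>F w in at z within E - {0}. w \<in> S \<longleftrightarrow> z \<in> S"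
        using ev_E by eventually_elim (use z in \<open>auto simp: S\<close>)
      show "\<forall>\<^sub>F w in at z within E - {0}. (w \<in> S \<inter> A) = (z \<in> S \<inter> A)"
      \<comment> \<open>Only the part of \<open>{g = t}\<close> inside \<open>S\<close> is known to
        be null. Near a point outside \<open>S\<close>, membership in \<open>S \<inter> A\<close> is
        already constant, so the level of \<open>g\<close> matters only when
        \<open>z \<in> S\<close>; there the signs are flipped to fit the form of
        \<open>side\<close>.\<close>
      proof (cases "z \<in> S")
        case True
        with z have "- g z \<noteq> - t" by auto
        then have "\<forall>\<^sub>F w in at z within E - {0}. - t \<le> - g w \<longleftrightarrow> - t \<le> - g z"
          using z g by (intro side continuous_intros) (auto intro: continuous_on_subset)
        with 1 show ?thesis by eventually_elim (auto simp: A_def)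
      next
        case False
        with 1 show ?thesis by (auto elim: eventually_mono)
      qed
    qed (use SA in auto)
    moreover have "N1 \<union> (S \<inter> {z. g z = t}) \<in> null_sets \<nu>"
    proof (intro null_sets.Un N1_null null_setsI gt)
      have "closed {z. g z = t}" using g by (intro closed_Collect_eq) auto
      then show "S \<inter> {z. g z = t} \<in> sets \<nu>"
        using S_closed S0 by (auto simp: in_\<nu> S)
    qed
    ultimately show ?thesis by (rule null_sub)
  qed
  have frW: "emeasure \<nu> (top_of_set (E - {0}) frontier_of (W n)) = 0" for n
  proof -
    \<comment> \<open>Membership in \<open>W n\<close> can switch only on these levels; each is
      nonzero, hence null.\<close>
    define N where "N = {z \<in> E - {0}. norm z = real (Suc n)} \<union>
       (\<Union>j\<in>J. {z \<in> E - {0}. ls j z = 1 - 1 / real (n + 2)} \<union> {z \<in> E - {0}. ls j z = 1 + 1 / real (n + 2)})"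
    have frN: "top_of_set (E - {0}) frontier_of (W n) \<subseteq> N"
    proof (rule frontier_of_subset_if_locally_constant)
      fix z assume z: "z \<in> E - {0} - N"
      define d where "d = 1 / real (n + 2)"
      have "\<forall>\<^sub>F w in at z within E - {0}. real (Suc n) \<le> norm w \<longleftrightarrow> real (Suc n) \<le> norm z"
        using z by (intro side continuous_intros) (auto simp: N_def)
      moreover have "\<forall>\<^sub>F w in at z within E - {0}. \<forall>j\<in>J. - d \<le> - \<bar>ls j w - 1\<bar> \<longleftrightarrow> - d \<le> - \<bar>ls j z - 1\<bar>"
      proof (intro eventually_ball_finite ballI side continuous_intros cont J)
        fix j assume "j \<in> J"
        with z have "ls j z \<noteq> 1 - d" "ls j z \<noteq> 1 + d" by (auto simp: N_def d_def)
        then show "- \<bar>ls j z - 1\<bar> \<noteq> - d" by (auto simp: abs_if)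
      qed (use z in auto)
      ultimately show "\<forall>\<^sub>F w in at z within E - {0}. (w \<in> W n) = (z \<in> W n)"
        using ev_E by eventually_elim (use z in \<open>auto simp: W_def d_def\<close>)
    qed (use W in auto)
    have norm_null: "{z \<in> E - {0}. norm z = real (Suc n)} \<in> null_sets \<nu>"
      by (rule null) (auto intro: continuous_intros)
    have ls_null: "(\<Union>j\<in>J. {z \<in> E - {0}. ls j z = 1 - 1 / real (n + 2)} \<union>
        {z \<in> E - {0}. ls j z = 1 + 1 / real (n + 2)}) \<in> null_sets \<nu>"
      using J(1)
      by (intro null_sets_UN' null_sets.Un null_ls countable_finite)
         (auto simp: field_simps add_eq_0_iff)
    have "N \<in> null_sets \<nu>" unfolding N_def using norm_null ls_null by (rule null_sets.Un)
    with frN show ?thesis by (rule null_sub)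
  qed
  have limSA: "((\<lambda>u. p u (S \<inter> A)) \<longlongrightarrow> measure \<nu> (S \<inter> A)) at_top"
    unfolding p_def by (rule tail_preserving_tendsto[OF M E(1) tp SA frS])
  have limW: "((\<lambda>u. p u (W n)) \<longlongrightarrow> measure \<nu> (W n)) at_top" for n
    unfolding p_def by (rule tail_preserving_tendsto[OF M E(1) tp W frW])
  have W0: "(\<lambda>n. measure \<nu> (W n)) \<longlonglongrightarrow> 0"
  proof -
    have "(\<lambda>n. measure \<nu> (W n)) \<longlonglongrightarrow> measure \<nu> (\<Inter>n. W n)"
    proof (rule Lim_measure_decseq)
      show "range W \<subseteq> sets \<nu>" using W by (auto simp: in_\<nu>)
      show "decseq W"
      proof (rule decseq_SucI)
        fix n
        have "1 / real (Suc n + 2) \<le> 1 / real (n + 2)" by (simp add: frac_le)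
        then show "W (Suc n) \<subseteq> W n" by (fastforce simp: W_def)
      qed
      show "emeasure \<nu> (W n) \<noteq> \<infinity>" for n using emeasure_M0_finite[OF \<nu> E(1) W(2,3)] by (simp add: less_top)
    qed
    \<comment> \<open>If no \<open>ls j z\<close> equals 1, the finitely many distances to 1 are all
      positive, and both clauses of \<open>W n\<close> fail for large \<open>n\<close>.\<close>
    moreover have "(\<Inter>n. W n) \<subseteq> N1"
    proof
      fix z assume z: "z \<in> (\<Inter>n. W n)"
      show "z \<in> N1"
      proof (rule ccontr)
        assume "z \<notin> N1"
        moreover have "z \<in> E - {0}" using z by (auto simp: W_def)
        ultimately have ne: "\<And>j. j \<in> J \<Longrightarrow> 0 < \<bar>ls j z - 1\<bar>" by (auto simp: N1_def)
        have "(\<lambda>n. 1 / real (n + 2)) \<longlonglongrightarrow> 0"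
          using LIMSEQ_ignore_initial_segment[OF lim_1_over_n, of 2] by simp
        then have "\<forall>\<^sub>F n in sequentially. 1 / real (n + 2) < \<bar>ls j z - 1\<bar>" if "j \<in> J" for j
          using ne[OF that] by (rule order_tendstoD)
        then have "\<forall>\<^sub>F n in sequentially. \<forall>j\<in>J. 1 / real (n + 2) < \<bar>ls j z - 1\<bar>"
          using J(1) by (intro eventually_ball_finite) auto
        moreover have "\<forall>\<^sub>F n in sequentially. norm z < real n"
          using filterlim_real_sequentially by (simp add: filterlim_at_top_dense)
        ultimately have "\<forall>\<^sub>F n in sequentially. z \<notin> W n"
          by eventually_elim (auto simp: W_def not_le)
        then show False using z by (auto simp: eventually_sequentially)
      qed
    qed
    then have "emeasure \<nu> (\<Inter>n. W n) = 0" using N1_null by (rule null_sub)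
    ultimately show ?thesis by (simp add: measure_def)
  qed
  define q where "q u = u powr s * measure M {\<omega> \<in> space M. X u \<omega> \<in> {z \<in> E. \<forall>j\<in>J. u \<le> l j z} \<and>
              g (X u \<omega> /\<^sub>R u) \<le> t}" for u
  have diff: "\<forall>\<^sub>F u in at_top. \<bar>q u - p u (S \<inter> A)\<bar> \<le> p u (W n)" for n
  proof -
    have "\<forall>\<^sub>F u in at_top. \<forall>w\<in>E \<inter> cball 0 (real (Suc n)).
        \<bar>inverse u * l j (u *\<^sub>R w) - ls j w\<bar> < 1 / real (n + 2)" if "j \<in> J" for j
      by (rule asymptotic_loss_uniform_on_compact[of E "l j" "ls j"])
         (rule conv[OF that], use E(1) in \<open>auto intro: closed_Int_compact\<close>)
    then have "\<forall>\<^sub>F u in at_top. \<forall>j\<in>J. \<forall>w\<in>E \<inter> cball 0 (real (Suc n)).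
        \<bar>inverse u * l j (u *\<^sub>R w) - ls j w\<bar> < 1 / real (n + 2)"
      using J(1) by (intro eventually_ball_finite) auto
    then show ?thesis using eventually_gt_at_top[of 0]
    proof eventually_elim
      fix u :: real
      assume close: "\<forall>j\<in>J. \<forall>w\<in>E \<inter> cball 0 (real (Suc n)).
        \<bar>inverse u * l j (u *\<^sub>R w) - ls j w\<bar> < 1 / real (n + 2)" and u: "0 < u"
      have Xm [measurable]: "X u \<in> borel_measurable M" and XE: "\<And>\<omega>. \<omega> \<in> space M \<Longrightarrow> X u \<omega> \<in> E"
        using tp u by (auto simp: tail_preserving_def)
      have [measurable]: "g \<in> borel_measurable borel" using g by (rule borel_measurable_continuous_onI)
      have [measurable]: "(\<lambda>\<omega>. l j (X u \<omega>)) \<in> borel_measurable M" if "j \<in> J" for j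
        by (rule measurable_compose[OF measurable_restrict_space2 lm[OF that]]) (use XE in auto)
      define a where "a = {\<omega> \<in> space M. X u \<omega> \<in> {z \<in> E. \<forall>j\<in>J. u \<le> l j z} \<and> g (X u \<omega> /\<^sub>R u) \<le> t}"
      have "a = {\<omega> \<in> space M. (\<forall>j\<in>J. u \<le> l j (X u \<omega>)) \<and> g (X u \<omega> /\<^sub>R u) \<le> t}"
        using XE by (auto simp: a_def)
      also have "\<dots> \<in> events" using J(1) by measurable
      finally have a: "a \<in> events" .
      have b: "{\<omega> \<in> space M. X u \<omega> /\<^sub>R u \<in> B} \<in> events" if "B \<in> sets borel" for B
        using that by measurable
      \<comment> \<open>Off \<open>W n\<close> the point lies in the compact set on which the error
        is below \<open>1 / (n + 2)\<close>, while \<open>ls j w\<close> is farther than that from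
        1, so the scaled and the limit losses lie on the same side of 1.\<close>
      have key: "\<omega> \<in> a \<longleftrightarrow> X u \<omega> /\<^sub>R u \<in> S \<inter> A" if \<omega>: "\<omega> \<in> space M" "X u \<omega> /\<^sub>R u \<notin> W n" for \<omega>
      proof -
        define w where "w = X u \<omega> /\<^sub>R u"
        have Xw: "X u \<omega> = u *\<^sub>R w" using u by (simp add: w_def)
        have w: "w \<in> E" using XE[OF \<omega>(1)] E(2) u by (simp add: w_def cone_def)
        have nw: "norm w < real (Suc n)" "\<And>j. j \<in> J \<Longrightarrow> 1 / real (n + 2) < \<bar>ls j w - 1\<bar>"
          using \<omega>(2) w unfolding W_eq w_def[symmetric] by (auto simp: not_le)
        have "u \<le> l j (u *\<^sub>R w) \<longleftrightarrow> 1 \<le> ls j w" if j: "j \<in> J" for j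
        proof -
          have "\<bar>inverse u * l j (u *\<^sub>R w) - ls j w\<bar> < 1 / real (n + 2)"
            using close j w nw(1) by auto
          with nw(2)[OF j] have "1 \<le> inverse u * l j (u *\<^sub>R w) \<longleftrightarrow> 1 \<le> ls j w" by linarith
          then show ?thesis using u by (simp add: field_simps)
        qed
        then show ?thesis using w XE[OF \<omega>(1)] \<omega>(1) u
          unfolding a_def S A_def w_def[symmetric] by (auto simp: Xw)
      qed
      have "\<bar>measure M a - measure M {\<omega> \<in> space M. X u \<omega> /\<^sub>R u \<in> S \<inter> A}\<bar>
          \<le> measure M {\<omega> \<in> space M. X u \<omega> /\<^sub>R u \<in> W n}"
        by (intro abs_measure_diff_le a b SA W) (use key in \<open>auto simp: a_def\<close>)
      then show "\<bar>q u - p u (S \<inter> A)\<bar> \<le> p u (W n)"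
        unfolding q_def p_def a_def[symmetric] right_diff_distrib[symmetric]
        by (simp add: abs_mult mult_left_mono)
    qed
  qed
  have "(q \<longlongrightarrow> measure \<nu> (S \<inter> A)) at_top"
  proof (rule tendstoI)
    fix e :: real assume e: "0 < e"
    \<comment> \<open>The order of choice matters: \<open>n\<close> is fixed first, making the
      limiting mass of \<open>W n\<close> small, and only then does \<open>u\<close> grow.\<close>
    obtain n where n: "measure \<nu> (W n) < e / 2"
      using order_tendstoD(2)[OF W0, of "e / 2"] e by (auto simp: eventually_sequentially)
    have "\<forall>\<^sub>F u in at_top. p u (W n) < e / 2" using order_tendstoD(2)[OF limW n] .
    moreover have "\<forall>\<^sub>F u in at_top. dist (p u (S \<inter> A)) (measure \<nu> (S \<inter> A)) < e / 2"
      using tendstoD[OF limSA, of "e / 2"] e by simp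
    ultimately show "\<forall>\<^sub>F u in at_top. dist (q u) (measure \<nu> (S \<inter> A)) < e"
      using diff[of n] unfolding dist_real_def by eventually_elim linarith
  qed
  then show ?thesis by (simp add: q_def[abs_def] A_def)
qed

section \<open>Conditional laws\<close>

text \<open>Uniform limits preserve continuity. Once \<open>t > r0\<close>, dilation by
  \<open>t\<close> carries the compact set of unit directions into the region where \<open>f\<close>
  is continuous.\<close>

lemma density_regular_variation_continuous_on:
  fixes E :: "'a::euclidean_space set"
  assumes E: "closed E" "cone E" and rv: "density_regular_variation E f s \<phi>s"
  shows "continuous_on (unit_directions E) \<phi>s"
proof -
  obtain r0 where r0: "0 < r0" "continuous_on (E - cball 0 r0) f"
    using rv by (auto simp: density_regular_variation_def)
  have "unit_directions E = E \<inter> sphere 0 1" by (auto simp: unit_directions_def)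
  then have "compact (unit_directions E)" using E(1) by (simp add: closed_Int_compact)
  moreover have "unit_directions E \<subseteq> E - {0}" by (auto simp: unit_directions_def)
  ultimately have lim: "uniform_limit (unit_directions E)
      (\<lambda>t z. t powr (s + real DIM('a)) * f (t *\<^sub>R z)) \<phi>s at_top"
    using rv by (simp add: density_regular_variation_def)
  show ?thesis
  proof (rule uniform_limit_theorem[OF _ lim])
    show "\<forall>\<^sub>F t in at_top. continuous_on (unit_directions E)
        (\<lambda>z. t powr (s + real DIM('a)) * f (t *\<^sub>R z))"
      using eventually_gt_at_top[of r0]
    proof eventually_elim
      fix t assume "r0 < t"
      then have "(\<lambda>z. t *\<^sub>R z) ` unit_directions E \<subseteq> E - cball 0 r0"
        using r0(1) E(2) by (auto simp: unit_directions_def cone_def)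
      then have "continuous_on (unit_directions E) (\<lambda>z. f (t *\<^sub>R z))"
        by (rule continuous_on_compose2[OF r0(2) continuous_on_scaleR[OF continuous_on_const continuous_on_id]])
      then show "continuous_on (unit_directions E) (\<lambda>z. t powr (s + real DIM('a)) * f (t *\<^sub>R z))"
        by (intro continuous_intros)
    qed
  qed simp
qed

lemma measurable_uniform_measure_iff [simp]:
  "Y \<in> uniform_measure M A \<rightarrow>\<^sub>M N \<longleftrightarrow> Y \<in> M \<rightarrow>\<^sub>M N"
  by (rule arg_cong[where f = "\<lambda>S. Y \<in> S"], rule measurable_cong_sets) simp_all

lemma sets_conditional_law [simp]: "sets (conditional_law M Y A) = sets borel"
  by (simp add: conditional_law_def)

lemma prob_space_conditional_law:
  assumes "Y \<in> borel_measurable M" "emeasure M A \<noteq> 0" "emeasure M A \<noteq> \<infinity>"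
  shows "prob_space (conditional_law M Y A)"
  unfolding conditional_law_def using assms
  by (intro prob_space.prob_space_distr prob_space_uniform_measure) simp_all

lemma measure_conditional_law:
  assumes Y: "Y \<in> borel_measurable M" and A: "emeasure M A \<noteq> 0" "emeasure M A \<noteq> \<infinity>"
    and B: "B \<in> sets borel"
  shows "measure (conditional_law M Y A) B = measure M {\<omega> \<in> A. Y \<omega> \<in> B} / measure M A"
proof -
  have "A \<subseteq> space M" using emeasure_neq_0_sets[OF A(1)] by (rule sets.sets_into_space)
  then have eq: "A \<inter> (Y -` B \<inter> space M) = {\<omega> \<in> A. Y \<omega> \<in> B}" by auto
  have "measure (conditional_law M Y A) B = measure (uniform_measure M A) (Y -` B \<inter> space M)"
    unfolding conditional_law_def using Y B by (simp add: measure_distr)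
  also have "\<dots> = measure M {\<omega> \<in> A. Y \<omega> \<in> B} / measure M A"
    by (simp add: measure_uniform_measure[OF A measurable_sets[OF Y B]] eq)
  finally show ?thesis .
qed

theorem corollary1:
  fixes M :: "'w measure"
    and E :: "'a::euclidean_space set"
    and \<xi> :: "'w \<Rightarrow> 'a"
    and f :: "'a \<Rightarrow> real" and s :: real and \<phi>s :: "'a \<Rightarrow> real"
    and \<xi>u :: "real \<Rightarrow> 'w \<Rightarrow> 'a"
    and K :: nat and L Ls :: "nat \<Rightarrow> 'a \<Rightarrow> real"
    and \<J> :: "nat set set"
  defines "\<nu> \<equiv> tail_measure E s \<phi>s"
  assumes "prob_space M"
    and "closed E" and "cone E"
    and "distributed M lborel \<xi> (\<lambda>z. ennreal (f z))"
    and "\<And>z. 0 \<le> f z" and "\<And>z. z \<notin> E \<Longrightarrow> f z = 0"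
    and "density_regular_variation E f s \<phi>s"
    and "tail_preserving M E s \<nu> \<xi>u"
    and "asymptotically_homogeneous E K L Ls"
    and "\<And>J. J \<in> \<J> \<Longrightarrow> J \<noteq> {} \<and> J \<subseteq> {1..K}"
    and "regular_system E Ls \<J>"
  shows "\<forall>J\<in>\<J>.
    weakly_converges
      (\<lambda>u. conditional_law M (\<lambda>\<omega>. \<xi>u u \<omega> /\<^sub>R u)
             {\<omega> \<in> space M. \<xi>u u \<omega> \<in> joint_exceedance E L u J})
      (distr (uniform_measure \<nu> (joint_exceedance E Ls 1 J)) borel (\<lambda>z. z))
      at_top"
proof
  fix J assume J\<J>: "J \<in> \<J>"
  interpret prob_space M by fact
  note E = \<open>closed E\<close> \<open>cone E\<close>
  note tp = \<open>tail_preserving M E s \<nu> \<xi>u\<close>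
  have J: "finite J" "J \<noteq> {}" "J \<subseteq> {1..K}"
    using assms(11)[OF J\<J>] by (auto intro: finite_subset)
  have lm: "L j \<in> borel_measurable (restrict_space borel E)" if "j \<in> J" for j
    using assms(10) J(3) that by (auto simp: asymptotically_homogeneous_def)
  have conv: "((\<lambda>t. inverse t * L j (t *\<^sub>R \<zeta> t)) \<longlongrightarrow> Ls j z) at_top"
    if "j \<in> J" "\<And>t. \<zeta> t \<in> E" "z \<in> E" "(\<zeta> \<longlongrightarrow> z) at_top" for j \<zeta> z
    using assms(10) J(3) that unfolding asymptotically_homogeneous_def by blast
  have cont: "continuous_on E (Ls j)" if "j \<in> J" for j
    by (rule continuous_on_asymptotic_loss[of E "L j"]) (rule conv[OF that])
  have hom: "Ls j (c *\<^sub>R z) = c * Ls j z" if "j \<in> J" "z \<in> E" "0 < c" for j z c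
    by (rule asymptotic_loss_scaleR[of E "L j", OF _ E(2) that(2,3)]) (rule conv[OF that(1)])
  have zero: "Ls j 0 = 0" if "j \<in> J" "0 \<in> E" for j
    by (rule asymptotic_loss_zero[of E "L j", OF _ that(2)]) (rule conv[OF that(1)])
  have \<phi>_cont: "continuous_on (unit_directions E) \<phi>s"
    using E assms(8) by (rule density_regular_variation_continuous_on)
  have \<phi>_pos: "0 < \<phi>s z" if "z \<in> unit_directions E" for z
    using assms(8) that by (force simp: density_regular_variation_def unit_directions_def)
  have level: "emeasure \<nu> {z \<in> E - {0}. h z = a} = 0"
    if "continuous_on E h" "\<And>z c. z \<in> E \<Longrightarrow> 0 < c \<Longrightarrow> h (c *\<^sub>R z) = c * h z" "a \<noteq> 0" for h a
    unfolding \<nu>_def by (rule emeasure_tail_measure_level_set[OF E \<phi>_cont \<phi>_pos that])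
  define S where "S = joint_exceedance E Ls 1 J"
  have S: "S = {z \<in> E. \<forall>j\<in>J. 1 \<le> Ls j z}" by (simp add: S_def joint_exceedance_def)
  have S_closed: "closed S" unfolding S using E(1) cont by (rule closed_superlevel)
  have S0: "0 \<notin> S" using zero J(2) by (auto simp: S)
  then have S': "S = {z \<in> E - {0}. \<forall>j\<in>J. 1 \<le> Ls j z}" by (auto simp: S)
  have \<nu>: "\<nu> \<in> M0 E" using tp by (simp add: tail_preserving_def M0_tendsto_def)
  have S_fin: "emeasure \<nu> S \<noteq> \<infinity>"
  proof -
    have "S \<subseteq> E - {0}" using S' by blast
    moreover have "0 \<notin> closure S" using S0 by (simp add: closure_closed[OF S_closed])
    ultimately show ?thesis using emeasure_M0_finite[OF \<nu> E(1)] by (simp add: less_top)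
  qed
  have leb: "emeasure lebesgue {z \<in> E. \<forall>j\<in>J. 1 \<le> Ls j z} \<noteq> 0"
    using assms(12) J\<J> by (simp add: regular_system_def joint_exceedance_def)
  \<comment> \<open>Regularity rules out Lebesgue measure zero, and positivity of
    \<open>\<phi>s\<close> transfers this to \<open>\<nu>\<close>, so the limiting quotient is well
    defined.\<close>
  have S_pos: "emeasure \<nu> S \<noteq> 0"
    unfolding S' \<nu>_def
    by (rule emeasure_tail_measure_superlevel_pos[OF E \<phi>_cont \<phi>_pos J(1) cont hom leb])
  have id_\<nu>: "(\<lambda>z. z) \<in> borel_measurable \<nu>"
    by (simp add: \<nu>_def measurable_cong_sets[OF sets_tail_measure refl] measurable_restrict_space1)
  define X where "X u \<omega> = \<xi>u u \<omega> /\<^sub>R u" for u \<omega>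
  define A where "A u = {\<omega> \<in> space M. \<xi>u u \<omega> \<in> joint_exceedance E L u J}" for u
  have X: "X u \<in> borel_measurable M" if "0 < u" for u
  proof -
    have [measurable]: "\<xi>u u \<in> borel_measurable M" using tp that by (simp add: tail_preserving_def)
    show ?thesis unfolding X_def[abs_def] by measurable
  qed
  have lim: "((\<lambda>u. u powr s * measure M {\<omega> \<in> A u. g (X u \<omega>) \<le> t})
      \<longlongrightarrow> measure \<nu> {z \<in> S. g z \<le> t}) at_top"
    if "continuous_on UNIV g" "emeasure \<nu> {z \<in> S. g z = t} = 0" for g :: "'a \<Rightarrow> real" and t
  proof -
    have gt: "emeasure \<nu> (S \<inter> {z. g z = t}) = 0" using that(2) by (simp add: Int_def)
    have "((\<lambda>u. u powr s * measure M {\<omega> \<in> space M. \<xi>u u \<omega> \<in> {z \<in> E. \<forall>j\<in>J. u \<le> L j z} \<and>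
              g (\<xi>u u \<omega> /\<^sub>R u) \<le> t}) \<longlongrightarrow> measure \<nu> (S \<inter> {z. g z \<le> t})) at_top"
      by (rule scaled_exceedance_tendsto[OF assms(2) E tp _ J(1,2) _ _ that(1) S gt])
         (rule level lm conv; assumption)+
    moreover have "{\<omega> \<in> space M. \<xi>u u \<omega> \<in> {z \<in> E. \<forall>j\<in>J. u \<le> L j z} \<and> g (\<xi>u u \<omega> /\<^sub>R u) \<le> t}
        = {\<omega> \<in> A u. g (X u \<omega>) \<le> t}" for u
      by (auto simp: A_def X_def joint_exceedance_def)
    ultimately show ?thesis by (simp add: Int_def)
  qed
  \<comment> \<open>With \<open>g\<close> constantly 0 and \<open>t = 1\<close> the sublevel set is
    everything and the level set is empty, so the limit of the normalising constants is an
    instance.\<close>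
  have limA: "((\<lambda>u. u powr s * measure M (A u)) \<longlongrightarrow> measure \<nu> S) at_top"
    using lim[of "\<lambda>_. 0" 1] by simp
  have "0 < measure \<nu> S" using S_pos S_fin by (simp add: measure_def enn2real_positive_iff less_top zero_less_iff_neq_zero)
  from order_tendstoD(1)[OF limA this]
  \<comment> \<open>A positive limit forces the conditioning events to have positive probability
    eventually, so the conditional laws are probability measures from then on.\<close>
  have A_pos: "\<forall>\<^sub>F u in at_top. 0 < u \<and> emeasure M (A u) \<noteq> 0"
    using eventually_gt_at_top[of 0]
    by eventually_elim (auto simp: emeasure_eq_measure zero_less_mult_iff)
  \<comment> \<open>The limit law is itself a conditional law of the identity, with
    \<open>\<nu>\<close> in the role of the underlying measure, so the same quotient formula serves
    both sides.\<close>
  have "weakly_converges (\<lambda>u. conditional_law M (X u) (A u)) (conditional_law \<nu> (\<lambda>z. z) S) at_top"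
  proof (rule weakly_convergesI_sublevel)
    show "\<forall>\<^sub>F u in at_top. sets (conditional_law M (X u) (A u)) = sets borel \<and>
        prob_space (conditional_law M (X u) (A u))"
      using A_pos by eventually_elim
        (auto intro!: prob_space_conditional_law X)
    show "sets (conditional_law \<nu> (\<lambda>z. z) S) = sets borel" by simp
    show "prob_space (conditional_law \<nu> (\<lambda>z. z) S)"
      by (rule prob_space_conditional_law[OF id_\<nu> S_pos S_fin])
    fix g :: "'a \<Rightarrow> real" and t
    assume g: "continuous_on UNIV g" and gt: "measure (conditional_law \<nu> (\<lambda>z. z) S) {z. g z = t} = 0"
    have [measurable]: "g \<in> borel_measurable borel" using g by (rule borel_measurable_continuous_onI)
    have B: "{z. g z = t} \<in> sets borel" "{z. g z \<le> t} \<in> sets borel" by measurable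
    \<comment> \<open>\<open>measure\<close> is 0 also on sets of infinite mass, so a finite bound
      is needed before a vanishing \<open>measure\<close> yields a vanishing
      \<open>emeasure\<close>.\<close>
    have "emeasure \<nu> {z \<in> S. g z = t} \<le> emeasure \<nu> S"
      using emeasure_neq_0_sets[OF S_pos] by (intro emeasure_mono) auto
    with S_fin have "emeasure \<nu> {z \<in> S. g z = t} \<noteq> \<infinity>" by (auto simp: top_unique)
    moreover have "measure \<nu> {z \<in> S. g z = t} = 0"
      using gt \<open>0 < measure \<nu> S\<close> measure_conditional_law[OF id_\<nu> S_pos S_fin B(1)] by simp
    ultimately have "emeasure \<nu> {z \<in> S. g z = t} = 0"
      by (simp add: emeasure_eq_ennreal_measure)
    from tendsto_divide[OF lim[OF g this] limA] \<open>0 < measure \<nu> S\<close>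
    have "((\<lambda>u. (u powr s * measure M {\<omega> \<in> A u. g (X u \<omega>) \<le> t}) / (u powr s * measure M (A u)))
       \<longlongrightarrow> measure (conditional_law \<nu> (\<lambda>z. z) S) {z. g z \<le> t}) at_top"
      by (simp add: measure_conditional_law[OF id_\<nu> S_pos S_fin B(2)])
    then show "((\<lambda>u. measure (conditional_law M (X u) (A u)) {z. g z \<le> t})
       \<longlongrightarrow> measure (conditional_law \<nu> (\<lambda>z. z) S) {z. g z \<le> t}) at_top"
    proof (rule Lim_transform_eventually)
      \<comment> \<open>The factors \<open>u powr s\<close> cancel for \<open>u > 0\<close>, leaving
        conditional probabilities.\<close>
      show "\<forall>\<^sub>F u in at_top. (u powr s * measure M {\<omega> \<in> A u. g (X u \<omega>) \<le> t}) / (u powr s * measure M (A u))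
          = measure (conditional_law M (X u) (A u)) {z. g z \<le> t}"
        using A_pos by eventually_elim (simp add: measure_conditional_law[OF X _ _ B(2)])
    qed
  qed
  then show "weakly_converges
      (\<lambda>u. conditional_law M (\<lambda>\<omega>. \<xi>u u \<omega> /\<^sub>R u)
             {\<omega> \<in> space M. \<xi>u u \<omega> \<in> joint_exceedance E L u J})
      (distr (uniform_measure \<nu> (joint_exceedance E Ls 1 J)) borel (\<lambda>z. z))
      at_top"
    by (simp add: X_def[abs_def] A_def S_def conditional_law_def)
qed

end
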